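(* Let $F$ be a field of characteristic zero equipped with an automorphism $\sigma$ and a derivation $\partial$ such that $\sigma\partial=\partial\sigma$. Let $\nu\ge 1$ and $A\in GL_\nu(F)$. Then there exists a $(\sigma,\partial)$-extension $\mathcal{R}^\#$ of $F$ such that: (1) $\mathcal{R}^\#$ is generated over $F$ as a $\partial$-ring by (the entries of) $Z\in GL_\nu(\mathcal{R}^\#)$ and $\frac{1}{\det(Z)}$, for some matrix $Z$ satisfying $\sigma(Z)=AZ$; (2) $\mathcal{R}^\#$ is a simple $\sigma$-ring, i.e. it has no nontrivial ideals stable under $\sigma$.
   Context: A $(\sigma,\partial)$-extension of $F$ is a (commutative) ring extension $\mathcal{R}$ of $F$ equipped with an extension of the automorphism $\sigma$ and an extension of the derivation $\partial$ that still commute with each other. "Generated over $F$ as a $\partial$-ring by a set" means generated as an $F$-algebra by all the derivatives $\partial^i$, $i\ge 0$, of the elements of that set. No assumption is made on the field of constants $F^\sigma=\{f\in F:\sigma(f)=f\}$. *)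

theory Defs
  imports
    "HOL-Algebra.Algebraic_Closure_Type"
    "HOL-Algebra.Generated_Rings"
    "HOL-Library.Poly_Mapping"
    "Jordan_Normal_Form.Determinant"
begin

section \<open>Rings with a commuting automorphism and derivation\<close>

definition ring_derivation :: "('a, 'm) ring_scheme \<Rightarrow> ('a \<Rightarrow> 'a) \<Rightarrow> bool" where
  "ring_derivation R d \<longleftrightarrow>
     d \<in> carrier R \<rightarrow> carrier R \<and>
     (\<forall>x\<in>carrier R. \<forall>y\<in>carrier R. d (x \<oplus>\<^bsub>R\<^esub> y) = d x \<oplus>\<^bsub>R\<^esub> d y) \<and>
     (\<forall>x\<in>carrier R. \<forall>y\<in>carrier R.
        d (x \<otimes>\<^bsub>R\<^esub> y) = (d x \<otimes>\<^bsub>R\<^esub> y) \<oplus>\<^bsub>R\<^esub> (x \<otimes>\<^bsub>R\<^esub> d y))"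

definition sd_ring :: "('a, 'm) ring_scheme \<Rightarrow> ('a \<Rightarrow> 'a) \<Rightarrow> ('a \<Rightarrow> 'a) \<Rightarrow> bool" where
  "sd_ring R s d \<longleftrightarrow>
     cring R \<and> s \<in> ring_iso R R \<and> ring_derivation R d \<and>
     (\<forall>x\<in>carrier R. s (d x) = d (s x))"

text \<open>The inclusion of the base ring into the extension is an injective ring
  homomorphism \<open>\<iota>\<close>, along which \<open>s'\<close> and \<open>d'\<close> extend \<open>s\<close> and \<open>d\<close>. The extension \<open>s'\<close>
  is again required to be an automorphism.\<close>

definition sd_extension ::
  "('a, 'm) ring_scheme \<Rightarrow> ('a \<Rightarrow> 'a) \<Rightarrow> ('a \<Rightarrow> 'a) \<Rightarrow>
   ('b, 'n) ring_scheme \<Rightarrow> ('b \<Rightarrow> 'b) \<Rightarrow> ('b \<Rightarrow> 'b) \<Rightarrow> ('a \<Rightarrow> 'b) \<Rightarrow> bool" where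
  "sd_extension F s d R s' d' \<iota> \<longleftrightarrow>
     sd_ring F s d \<and> sd_ring R s' d' \<and>
     \<iota> \<in> Ring.ring_hom F R \<and> inj_on \<iota> (carrier F) \<and>
     (\<forall>x\<in>carrier F. s' (\<iota> x) = \<iota> (s x)) \<and>
     (\<forall>x\<in>carrier F. d' (\<iota> x) = \<iota> (d x))"

definition d_generated_by ::
  "('a, 'm) ring_scheme \<Rightarrow> ('b, 'n) ring_scheme \<Rightarrow> ('b \<Rightarrow> 'b) \<Rightarrow> ('a \<Rightarrow> 'b) \<Rightarrow> 'b set \<Rightarrow> bool" where
  "d_generated_by F R d' \<iota> S \<longleftrightarrow>
     S \<subseteq> carrier R \<and>
     generate_ring R (\<iota> ` carrier F \<union> {(d' ^^ i) x |i x. x \<in> S}) = carrier R"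

definition simple_s_ring :: "('b, 'n) ring_scheme \<Rightarrow> ('b \<Rightarrow> 'b) \<Rightarrow> bool" where
  "simple_s_ring R s \<longleftrightarrow>
     \<one>\<^bsub>R\<^esub> \<noteq> \<zero>\<^bsub>R\<^esub> \<and>
     (\<forall>I. ideal I R \<and> s ` I \<subseteq> I \<longrightarrow> I = {\<zero>\<^bsub>R\<^esub>} \<or> I = carrier R)"


section \<open>Matrices over a ring given by a carrier\<close>

text \<open>The matrix operations of the library are those of a type class; these are their
  counterparts for a ring record, on the same matrix type.\<close>

definition ring_mat_mult :: "('b, 'n) ring_scheme \<Rightarrow> 'b mat \<Rightarrow> 'b mat \<Rightarrow> 'b mat" where
  "ring_mat_mult R M N =
     mat (dim_row M) (dim_col N)
       (\<lambda>(i, j). \<Oplus>\<^bsub>R\<^esub>k\<in>{0..<dim_row N}. M $$ (i, k) \<otimes>\<^bsub>R\<^esub> N $$ (k, j))"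

definition ring_mat_one :: "('b, 'n) ring_scheme \<Rightarrow> nat \<Rightarrow> 'b mat" where
  "ring_mat_one R n = mat n n (\<lambda>(i, j). if i = j then \<one>\<^bsub>R\<^esub> else \<zero>\<^bsub>R\<^esub>)"

definition ring_mats :: "('b, 'n) ring_scheme \<Rightarrow> nat \<Rightarrow> 'b mat set" where
  "ring_mats R n = {M \<in> carrier_mat n n. elements_mat M \<subseteq> carrier R}"

definition ring_GL :: "('b, 'n) ring_scheme \<Rightarrow> nat \<Rightarrow> 'b mat set" where
  "ring_GL R n =
     {M \<in> ring_mats R n. \<exists>N\<in>ring_mats R n.
        ring_mat_mult R M N = ring_mat_one R n \<and> ring_mat_mult R N M = ring_mat_one R n}"

definition ring_det :: "('b, 'n) ring_scheme \<Rightarrow> 'b mat \<Rightarrow> 'b" where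
  "ring_det R M =
     (\<Oplus>\<^bsub>R\<^esub>p\<in>{p. p permutes {0..<dim_row M}}.
        (if evenperm p then \<one>\<^bsub>R\<^esub> else \<ominus>\<^bsub>R\<^esub> \<one>\<^bsub>R\<^esub>) \<otimes>\<^bsub>R\<^esub>
        (\<Otimes>\<^bsub>R\<^esub>i\<in>{0..<dim_row M}. M $$ (i, p i)))"

text \<open>On the ring record of a type these notions are the ones of the library.\<close>

lemma type_ring_simps [simp]:
  "carrier ring_of_type_algebra = (UNIV :: 'a::comm_ring_1 set)"
  "x \<otimes>\<^bsub>ring_of_type_algebra\<^esub> y = x * (y :: 'a)"
  "x \<oplus>\<^bsub>ring_of_type_algebra\<^esub> y = x + (y :: 'a)"
  "\<one>\<^bsub>ring_of_type_algebra\<^esub> = (1 :: 'a)"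
  "\<zero>\<^bsub>ring_of_type_algebra\<^esub> = (0 :: 'a)"
  by (simp_all add: ring_of_type_algebra_def)

lemma type_ring_uminus [simp]:
  "\<ominus>\<^bsub>ring_of_type_algebra\<^esub> x = - (x :: 'a::comm_ring_1)"
proof -
  interpret cring "ring_of_type_algebra :: 'a ring" ..
  show ?thesis using minus_equality[of "- x" x] by simp
qed

lemma type_ring_finsum:
  assumes "finite S"
  shows "(\<Oplus>\<^bsub>ring_of_type_algebra\<^esub>x\<in>S. f x) = (\<Sum>x\<in>S. f x :: 'a::comm_ring_1)"
proof -
  interpret cring "ring_of_type_algebra :: 'a ring" ..
  show ?thesis using assms by (induction S) auto
qed

lemma type_ring_finprod:
  assumes "finite S"
  shows "(\<Otimes>\<^bsub>ring_of_type_algebra\<^esub>x\<in>S. f x) = (\<Prod>x\<in>S. f x :: 'a::comm_ring_1)"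
proof -
  interpret cring "ring_of_type_algebra :: 'a ring" ..
  show ?thesis using assms by (induction S) auto
qed

lemma ring_det_type_ring:
  assumes "M \<in> carrier_mat n n"
  shows "ring_det ring_of_type_algebra M = det (M :: 'a::comm_ring_1 mat)"
proof -
  have dim: "dim_row M = n" "dim_col M = n"
    using assms by auto
  show ?thesis
    by (simp add: ring_det_def det_def dim type_ring_finsum type_ring_finprod
        finite_permutations sign_def, rule sum.cong) auto
qed

lemma ring_mat_mult_type_ring:
  assumes "M \<in> carrier_mat n n" "N \<in> carrier_mat n n"
  shows "ring_mat_mult ring_of_type_algebra M N = M * (N :: 'a::comm_ring_1 mat)"
  using assms by (intro eq_matI)
    (auto simp: ring_mat_mult_def type_ring_finsum scalar_prod_def)

lemma ring_GL_type_ring: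
  "M \<in> ring_GL ring_of_type_algebra n \<longleftrightarrow>
     M \<in> carrier_mat n n \<and> invertible_mat (M :: 'a::comm_ring_1 mat)"
proof -
  have unit: "ring_mat_one ring_of_type_algebra n = (1\<^sub>m n :: 'a mat)"
    by (auto simp: ring_mat_one_def)
  have mats: "ring_mats (ring_of_type_algebra :: 'a ring) n = carrier_mat n n"
    by (auto simp: ring_mats_def)
  show ?thesis
  proof
    assume "M \<in> ring_GL ring_of_type_algebra n"
    then obtain N where M: "M \<in> carrier_mat n n" and N: "N \<in> carrier_mat n n"
      and "ring_mat_mult ring_of_type_algebra M N = 1\<^sub>m n"
      and "ring_mat_mult ring_of_type_algebra N M = 1\<^sub>m n"
      unfolding ring_GL_def mats unit by blast
    then have "M * N = 1\<^sub>m n" "N * M = 1\<^sub>m n"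
      by (simp_all only: ring_mat_mult_type_ring[OF M N] ring_mat_mult_type_ring[OF N M])
    moreover have "square_mat M" "dim_row M = n" "dim_row N = n"
      using M N by simp_all
    ultimately show "M \<in> carrier_mat n n \<and> invertible_mat M"
      unfolding invertible_mat_def inverts_mat_def using M by metis
  next
    assume *: "M \<in> carrier_mat n n \<and> invertible_mat M"
    then obtain N where MN: "M * N = 1\<^sub>m n" and NM: "N * M = 1\<^sub>m (dim_row N)"
      unfolding invertible_mat_def inverts_mat_def by auto
    have "dim_col N = n" using arg_cong[OF MN, of dim_col] by simp
    moreover have "dim_row N = n" using arg_cong[OF NM, of dim_col] * by auto
    ultimately have N: "N \<in> carrier_mat n n" by auto
    moreover have "N * M = 1\<^sub>m n" using NM N by simp
    ultimately have "ring_mat_mult ring_of_type_algebra M N = 1\<^sub>m n"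
      "ring_mat_mult ring_of_type_algebra N M = 1\<^sub>m n"
      using * MN by (simp_all add: ring_mat_mult_type_ring[of _ n])
    then show "M \<in> ring_GL ring_of_type_algebra n"
      unfolding ring_GL_def mats unit using * N by blast
  qed
qed


section \<open>The type of the extension\<close>

text \<open>Existence of a ring has to be stated for rings on a fixed type. A ring that is
  generated as an \<open>'a\<close>-algebra by countably many elements is a quotient of the polynomial
  ring over \<open>'a\<close> in countably many variables, so the type of sets of such polynomials
  (which contains the cosets of every ideal) is large enough.\<close>

type_synonym 'a poly_coset = "((nat \<Rightarrow>\<^sub>0 nat) \<Rightarrow>\<^sub>0 'a) set"

end

theory Submission
  imports Defs "HOL-Computational_Algebra.Polynomial_Factorial"
begin

text \<open>
  Treat \<open>1/det Z\<close> as one more \<open>\<partial>\<close>-indeterminate \<open>w\<close>, with \<open>\<sigma>(w) = w/det A\<close>, and work in the polynomial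
  ring \<open>P\<close> in all derivatives of the entries of \<open>Z\<close> and of \<open>w\<close>, filtered by the order of the derivatives:
  \<open>P\<^sub>0 = F\<close>, \<open>P\<^sub>1 = F[Z, w]\<close>, and so on. The extension is \<open>P/m\<close>, where \<open>m\<close> is the union of ideals \<open>m\<^sub>i\<close> that are
  maximal among the proper \<open>\<sigma>\<close>-stable ideals of \<open>P\<^sub>i\<close> and satisfy \<open>\<partial> m\<^sub>i \<subseteq> m\<^sub>i\<^sub>+\<^sub>1\<close>, with
  \<open>w det Z - 1 \<in> m\<^sub>1\<close>. Maximality at every level makes \<open>P/m\<close> a simple \<open>\<sigma>\<close>-ring.

  The point is that \<open>m\<^sub>i \<union> \<partial> m\<^sub>i\<close> generates a proper ideal of \<open>P\<^sub>i\<^sub>+\<^sub>1\<close>. Since \<open>m\<^sub>i\<close> is radical, there is a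
  prime \<open>p\<close> of \<open>P\<^sub>i\<close>, minimal over \<open>m\<^sub>i\<close>, whose restriction to \<open>P\<^sub>i\<^sub>-\<^sub>1\<close> is minimal over \<open>m\<^sub>i\<^sub>-\<^sub>1\<close>; the
  derivation \<open>P\<^sub>i\<^sub>-\<^sub>1 \<rightarrow> P\<^sub>i\<close> then descends modulo \<open>p\<close>, and in characteristic zero it extends to the fraction
  field of \<open>P\<^sub>i/p\<close>. Sending the derivatives of order \<open>i\<close> to their values under that extension defines a
  homomorphism from \<open>P\<^sub>i\<^sub>+\<^sub>1\<close> to a field that annihilates \<open>m\<^sub>i\<close> and \<open>\<partial> m\<^sub>i\<close>.
\<close>

section \<open>Subrings, ideals and maximal invariant ideals\<close>

text \<open>Subrings and ideals are subsets of one ambient ring, so that different levels of the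
  filtration can be compared by inclusion.\<close>

definition is_subring :: "'r::comm_ring_1 set \<Rightarrow> bool" where
  "is_subring B \<longleftrightarrow> 1 \<in> B \<and> (\<forall>x\<in>B. \<forall>y\<in>B. x - y \<in> B \<and> x * y \<in> B)"

lemma is_subringD:
  assumes "is_subring B"
  shows "1 \<in> B" "0 \<in> B" "x \<in> B \<Longrightarrow> y \<in> B \<Longrightarrow> x - y \<in> B" "x \<in> B \<Longrightarrow> - x \<in> B"
    "x \<in> B \<Longrightarrow> y \<in> B \<Longrightarrow> x + y \<in> B" "x \<in> B \<Longrightarrow> y \<in> B \<Longrightarrow> x * y \<in> B"
    "x \<in> B \<Longrightarrow> x ^ n \<in> B"
proof -
  show one: "1 \<in> B" and diff: "x \<in> B \<Longrightarrow> y \<in> B \<Longrightarrow> x - y \<in> B"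
    and mult: "x \<in> B \<Longrightarrow> y \<in> B \<Longrightarrow> x * y \<in> B" for x y
    using assms by (auto simp: is_subring_def)
  show zero: "0 \<in> B" using diff[OF one one] by simp
  show minus: "x \<in> B \<Longrightarrow> - x \<in> B" for x using diff[OF zero, of x] by simp
  show "x \<in> B \<Longrightarrow> y \<in> B \<Longrightarrow> x + y \<in> B" using diff[of x "- y"] minus by simp
  show "x \<in> B \<Longrightarrow> x ^ n \<in> B" by (induction n) (auto intro: one mult)
qed

definition ideal_in :: "'r::comm_ring_1 set \<Rightarrow> 'r set \<Rightarrow> bool" where
  "ideal_in B I \<longleftrightarrow> I \<subseteq> B \<and> 0 \<in> I \<and> (\<forall>x\<in>I. \<forall>y\<in>I. x + y \<in> I) \<and> (\<forall>r\<in>B. \<forall>x\<in>I. r * x \<in> I)"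

lemma ideal_inI:
  assumes "I \<subseteq> B" "0 \<in> I" "\<And>x y. x \<in> I \<Longrightarrow> y \<in> I \<Longrightarrow> x + y \<in> I"
    "\<And>r x. r \<in> B \<Longrightarrow> x \<in> I \<Longrightarrow> r * x \<in> I"
  shows "ideal_in B I"
  using assms by (auto simp: ideal_in_def)

lemma ideal_inD:
  assumes "ideal_in B I"
  shows "x \<in> I \<Longrightarrow> x \<in> B" "0 \<in> I" "x \<in> I \<Longrightarrow> y \<in> I \<Longrightarrow> x + y \<in> I"
    "r \<in> B \<Longrightarrow> x \<in> I \<Longrightarrow> r * x \<in> I" "x \<in> I \<Longrightarrow> r \<in> B \<Longrightarrow> x * r \<in> I"
  using assms by (auto simp: ideal_in_def mult.commute)

lemma ideal_in_diff:
  assumes "is_subring B" "ideal_in B I" "x \<in> I" "y \<in> I"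
  shows "x - y \<in> I"
proof -
  have "(- 1) * y \<in> I"
    using assms by (intro ideal_inD(4)[of B]) (auto intro: is_subringD)
  thus ?thesis using ideal_inD(3)[OF assms(2,3)] by fastforce
qed

lemma ideal_in_restrict:
  assumes "ideal_in B' I" "is_subring B" "B \<subseteq> B'"
  shows "ideal_in B (I \<inter> B)"
  using assms by (auto simp: ideal_in_def intro: is_subringD)

lemma ideal_in_sum:
  assumes "ideal_in B I" "\<And>i. i \<in> A \<Longrightarrow> f i \<in> I"
  shows "sum f A \<in> I"
  using assms(2) by (induction A rule: infinite_finite_induct) (auto intro: ideal_inD[OF assms(1)])

lemma ideal_in_Union_chain:
  assumes "C \<noteq> {}" "\<And>I. I \<in> C \<Longrightarrow> ideal_in B I"
    and chain: "\<And>I J. I \<in> C \<Longrightarrow> J \<in> C \<Longrightarrow> I \<subseteq> J \<or> J \<subseteq> I"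
  shows "ideal_in B (\<Union>C)"
proof (rule ideal_inI)
  fix x y assume "x \<in> \<Union>C" "y \<in> \<Union>C"
  then obtain I J where "x \<in> I" "I \<in> C" "y \<in> J" "J \<in> C" by auto
  with chain[of I J] show "x + y \<in> \<Union>C"
    using assms(2) by (metis UnionI ideal_inD(3) subsetD)
next
  show "\<Union>C \<subseteq> B" "0 \<in> \<Union>C" "\<And>r x. r \<in> B \<Longrightarrow> x \<in> \<Union>C \<Longrightarrow> r * x \<in> \<Union>C"
    using assms(1) assms(2)[THEN ideal_inD(1)] assms(2)[THEN ideal_inD(2)] assms(2)[THEN ideal_inD(4)]
    by blast+
qed

text \<open>Properness is \<open>1 \<notin> M\<close>. Stability is one-sided; the converse
  direction follows from maximality in \<open>max_inv_ideal_vimage\<close>.\<close>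

definition max_inv_ideal :: "('r \<Rightarrow> 'r) \<Rightarrow> 'r::comm_ring_1 set \<Rightarrow> 'r set \<Rightarrow> bool" where
  "max_inv_ideal s B M \<longleftrightarrow> ideal_in B M \<and> s ` M \<subseteq> M \<and> 1 \<notin> M \<and>
     (\<forall>I. ideal_in B I \<and> s ` I \<subseteq> I \<and> 1 \<notin> I \<and> M \<subseteq> I \<longrightarrow> I = M)"

lemma max_inv_idealD:
  assumes "max_inv_ideal s B M"
  shows "ideal_in B M" "x \<in> M \<Longrightarrow> s x \<in> M" "1 \<notin> M"
    "ideal_in B I \<Longrightarrow> s ` I \<subseteq> I \<Longrightarrow> 1 \<notin> I \<Longrightarrow> M \<subseteq> I \<Longrightarrow> I = M"
  using assms unfolding max_inv_ideal_def by auto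

lemma max_inv_ideal_exists:
  assumes "ideal_in B J" "s ` J \<subseteq> J" "1 \<notin> J"
  obtains M where "J \<subseteq> M" "max_inv_ideal s B M"
proof -
  define S where "S = {I. ideal_in B I \<and> s ` I \<subseteq> I \<and> 1 \<notin> I \<and> J \<subseteq> I}"
  have "\<exists>M\<in>S. \<forall>I\<in>S. M \<subseteq> I \<longrightarrow> I = M"
  proof (rule subset_Zorn_nonempty)
    show "S \<noteq> {}" using assms by (auto simp: S_def)
    fix C assume C: "C \<noteq> {}" "subset.chain S C"
    then have "ideal_in B (\<Union>C)"
      by (intro ideal_in_Union_chain) (auto simp: subset_chain_def S_def)
    moreover have "\<And>I. I \<in> C \<Longrightarrow> s ` I \<subseteq> I \<and> 1 \<notin> I \<and> J \<subseteq> I"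
      using C(2) by (auto simp: S_def subset_chain_def)
    ultimately show "\<Union>C \<in> S"
      using C(1) unfolding S_def by blast
  qed
  then obtain M where "M \<in> S" "\<forall>I\<in>S. M \<subseteq> I \<longrightarrow> I = M" by blast
  then have "J \<subseteq> M" "max_inv_ideal s B M"
    unfolding S_def max_inv_ideal_def by blast+
  then show ?thesis by (rule that)
qed

text \<open>\<open>M' \<inter> B\<close> is itself a proper stable ideal of \<open>B\<close>
  containing \<open>M\<close>, so maximality leaves no room. This makes consecutive ideals of the
  tower compatible.\<close>

lemma max_inv_ideal_restrict:
  assumes "max_inv_ideal s B M" "max_inv_ideal s B' M'" "is_subring B" "B \<subseteq> B'" "s ` B \<subseteq> B" "M \<subseteq> M'"
  shows "M' \<inter> B = M"
proof (rule max_inv_idealD(4)[OF assms(1)])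
  show "ideal_in B (M' \<inter> B)"
    using ideal_in_restrict max_inv_idealD(1)[OF assms(2)] assms by blast
  show "s ` (M' \<inter> B) \<subseteq> M' \<inter> B" "1 \<notin> M' \<inter> B" "M \<subseteq> M' \<inter> B"
    using assms max_inv_idealD[OF assms(2)] ideal_inD(1)[OF max_inv_idealD(1)[OF assms(1)]] by auto
qed

text \<open>The preimage of \<open>M\<close> in \<open>B\<close> under \<open>s\<close> is stable,
  contains \<open>M\<close>, and is proper because \<open>s 1 = 1\<close>; maximality makes it equal
  to \<open>M\<close>. Injectivity of the induced map on the quotient rests on this.\<close>

lemma max_inv_ideal_vimage:
  assumes s: "comm_ring_hom s" and M: "max_inv_ideal s B M" and B: "is_subring B" "s ` B \<subseteq> B"
    and x: "x \<in> B" "s x \<in> M"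
  shows "x \<in> M"
proof -
  interpret comm_ring_hom s by fact
  note [intro] = ideal_inD[OF max_inv_idealD(1)[OF M]]
  have "{x \<in> B. s x \<in> M} = M"
  proof (rule max_inv_idealD(4)[OF M])
    show "ideal_in B {x \<in> B. s x \<in> M}"
      using B by (intro ideal_inI) (auto simp: hom_distribs intro: is_subringD)
  qed (use M B in \<open>auto dest: max_inv_idealD\<close>)
  with x show ?thesis by blast
qed

text \<open>The radical of \<open>M\<close> in \<open>B\<close> is again stable and proper, hence
  equal to \<open>M\<close>.\<close>

lemma max_inv_ideal_radical:
  assumes s: "comm_ring_hom s" and M: "max_inv_ideal s B M" and B: "is_subring B" "s ` B \<subseteq> B"
    and x: "x \<in> B" "x ^ n \<in> M"
  shows "x \<in> M"
proof -
  interpret comm_ring_hom s by fact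
  note I = ideal_inD[OF max_inv_idealD(1)[OF M]] and BD = is_subringD[OF B(1)]
  have mono: "y ^ k \<in> M" if "y ^ l \<in> M" "l \<le> k" "y \<in> B" for y k l
    using I(5)[OF that(1), of "y ^ (k - l)"] that by (auto simp flip: power_add intro: BD)
  have nat_B: "of_nat k \<in> B" for k by (induction k) (auto intro: BD)
  have "{x \<in> B. \<exists>n. x ^ n \<in> M} = M"
  proof (rule max_inv_idealD(4)[OF M])
    show "ideal_in B {x \<in> B. \<exists>n. x ^ n \<in> M}"
    proof (rule ideal_inI)
      fix x y assume "x \<in> {x \<in> B. \<exists>n. x ^ n \<in> M}" "y \<in> {x \<in> B. \<exists>n. x ^ n \<in> M}"
      then obtain m n where mn: "x \<in> B" "y \<in> B" "x ^ m \<in> M" "y ^ n \<in> M" by auto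
      \<comment> \<open>Each term of the binomial expansion has \<open>k \<ge> m\<close> or
        \<open>m + n - k \<ge> n\<close>.\<close>
      have "of_nat ((m + n) choose k) * x ^ k * y ^ (m + n - k) \<in> M" for k
      proof (cases "k \<ge> m")
        case True
        have "x ^ k \<in> M" using mono mn True by blast
        then show ?thesis by (intro I(4) I(5) nat_B BD mn)
      next
        case False
        then have "y ^ (m + n - k) \<in> M" by (intro mono[OF mn(4)]) (use mn in auto)
        then show ?thesis by (intro I(4) nat_B BD mn)
      qed
      then have "(x + y) ^ (m + n) \<in> M"
        unfolding binomial_ring by (intro ideal_in_sum[OF max_inv_idealD(1)[OF M]])
      with mn show "x + y \<in> {x \<in> B. \<exists>n. x ^ n \<in> M}" by (auto intro: BD)
    next
      fix r x assume "r \<in> B" "x \<in> {x \<in> B. \<exists>n. x ^ n \<in> M}"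
      then show "r * x \<in> {x \<in> B. \<exists>n. x ^ n \<in> M}"
        by (auto simp: power_mult_distrib intro!: BD exI I(4))
    qed (use BD I(2) in \<open>auto intro!: exI[of _ 1]\<close>)
    show "s ` {x \<in> B. \<exists>n. x ^ n \<in> M} \<subseteq> {x \<in> B. \<exists>n. x ^ n \<in> M}"
      using B(2) max_inv_idealD(2)[OF M] by (fastforce simp flip: hom_power)
    show "M \<subseteq> {x \<in> B. \<exists>n. x ^ n \<in> M}"
      using I(1) by (auto intro: exI[of _ 1])
  qed (use max_inv_idealD(3)[OF M] in auto)
  with x show ?thesis by blast
qed

subsection \<open>Minimal primes over a radical ideal\<close>

text \<open>Minimal primes over a radical ideal are handled through their complements, the maximal
  multiplicative sets avoiding it. In this form one can be enlarged from a subring to the whole ring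
  by Zorn's lemma.\<close>

definition mult_avoiding :: "'r::comm_ring_1 set \<Rightarrow> 'r set \<Rightarrow> 'r set \<Rightarrow> bool" where
  "mult_avoiding B I S \<longleftrightarrow> S \<subseteq> B \<and> 1 \<in> S \<and> (\<forall>x\<in>S. \<forall>y\<in>S. x * y \<in> S) \<and> S \<inter> I = {}"

definition max_mult_avoiding :: "'r::comm_ring_1 set \<Rightarrow> 'r set \<Rightarrow> 'r set \<Rightarrow> bool" where
  "max_mult_avoiding B I S \<longleftrightarrow> mult_avoiding B I S \<and> (\<forall>T. mult_avoiding B I T \<and> S \<subseteq> T \<longrightarrow> T = S)"

lemma max_mult_avoiding_exists:
  assumes "mult_avoiding B I S0"
  obtains S where "S0 \<subseteq> S" "max_mult_avoiding B I S"
proof -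
  define \<S> where "\<S> = {S. mult_avoiding B I S \<and> S0 \<subseteq> S}"
  have "\<exists>S\<in>\<S>. \<forall>T\<in>\<S>. S \<subseteq> T \<longrightarrow> T = S"
  proof (rule subset_Zorn_nonempty)
    show "\<S> \<noteq> {}" using assms by (auto simp: \<S>_def)
    fix C assume C: "C \<noteq> {}" "subset.chain \<S> C"
    have "x * y \<in> \<Union>C" if xy: "x \<in> T" "T \<in> C" "y \<in> U" "U \<in> C" for x y T U
    proof -
      from C(2) xy have "T \<subseteq> U \<or> U \<subseteq> T" unfolding subset_chain_def by blast
      then obtain Z where "Z \<in> C" "x \<in> Z" "y \<in> Z" using xy by blast
      moreover then have "mult_avoiding B I Z" using C by (auto simp: subset_chain_def \<S>_def)
      ultimately show ?thesis unfolding mult_avoiding_def by blast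
    qed
    moreover have "\<And>S. S \<in> C \<Longrightarrow> S \<subseteq> B \<and> 1 \<in> S \<and> S \<inter> I = {} \<and> S0 \<subseteq> S"
      using C(2) by (auto simp: \<S>_def subset_chain_def mult_avoiding_def)
    ultimately show "\<Union>C \<in> \<S>"
      using C(1) unfolding \<S>_def mult_avoiding_def by blast
  qed
  then obtain S where "S \<in> \<S>" "\<forall>T\<in>\<S>. S \<subseteq> T \<longrightarrow> T = S" by blast
  then have "S0 \<subseteq> S" "max_mult_avoiding B I S"
    unfolding \<S>_def max_mult_avoiding_def by blast+
  then show ?thesis by (rule that)
qed

definition prime_in :: "'r::comm_ring_1 set \<Rightarrow> 'r set \<Rightarrow> bool" where
  "prime_in B P \<longleftrightarrow> ideal_in B P \<and> 1 \<notin> P \<and> (\<forall>x\<in>B. \<forall>y\<in>B. x * y \<in> P \<longrightarrow> x \<in> P \<or> y \<in> P)"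

lemma prime_in_power:
  assumes "prime_in B P" "is_subring B" "x \<in> B" "x ^ n \<in> P"
  shows "x \<in> P"
  using assms(4) by (induction n) (use assms(1-3) in \<open>auto simp: prime_in_def intro: is_subringD\<close>)

context
  fixes B I S :: "'r::comm_ring_1 set"
  assumes B: "is_subring B" and I: "ideal_in B I" and rad: "\<And>x n. x \<in> B \<Longrightarrow> x ^ n \<in> I \<Longrightarrow> x \<in> I"
    and S: "max_mult_avoiding B I S"
begin

text \<open>Adjoining \<open>x\<close> to \<open>S\<close> gives a larger multiplicative set, which
  by maximality meets \<open>I\<close>: some \<open>x ^ n * y\<close> with \<open>y \<in> S\<close>
  lies in \<open>I\<close>. Radicality then reduces the exponent to one.\<close>

lemma max_mult_avoiding_witness:
  assumes "x \<in> B" "x \<notin> S"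
  obtains y where "y \<in> S" "x * y \<in> I"
proof -
  have S': "S \<subseteq> B" "1 \<in> S" "x \<in> S \<Longrightarrow> y \<in> S \<Longrightarrow> x * y \<in> S" "S \<inter> I = {}" for x y
    using S by (auto simp: max_mult_avoiding_def mult_avoiding_def)
  define T where "T = {x ^ n * y |n y. y \<in> S}"
  have "S \<subseteq> T" by (force simp: T_def intro: exI[of _ 0])
  have "x \<in> T" using S'(2) by (auto simp: T_def intro!: exI[of _ 1])
  have "\<not> mult_avoiding B I T"
    using S \<open>S \<subseteq> T\<close> \<open>x \<in> T\<close> assms by (auto simp: max_mult_avoiding_def)
  moreover have "T \<subseteq> B" using S'(1) assms by (auto simp: T_def intro!: is_subringD[OF B])
  moreover have "a * b \<in> T" if "a \<in> T" "b \<in> T" for a b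
  proof -
    from that obtain m n y z where "a = x ^ m * y" "b = x ^ n * z" "y \<in> S" "z \<in> S"
      by (auto simp: T_def)
    then have "a * b = x ^ (m + n) * (y * z)" "y * z \<in> S" using S'(3) by (auto simp: power_add)
    then show ?thesis unfolding T_def by blast
  qed
  ultimately have "T \<inter> I \<noteq> {}" using \<open>S \<subseteq> T\<close> S'(2) unfolding mult_avoiding_def by blast
  then obtain n y where y: "y \<in> S" "x ^ n * y \<in> I" by (auto simp: T_def)
  then have "y \<in> B" using S' by auto
  \<comment> \<open>The factor \<open>x * y ^ n\<close> completes the product to a power of
    \<open>x * y\<close>, also when \<open>n = 0\<close>.\<close>
  have "x ^ n * y * (x * y ^ n) \<in> I"
    by (rule ideal_inD(5)[OF I y(2)]) (intro is_subringD[OF B] assms(1) \<open>y \<in> B\<close>)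
  also have "x ^ n * y * (x * y ^ n) = (x * y) ^ Suc n" by (simp add: power_mult_distrib mult_ac)
  finally have "x * y \<in> I" by (rule rad[rotated]) (intro is_subringD[OF B] assms(1) \<open>y \<in> B\<close>)
  with y(1) show ?thesis using that by blast
qed

text \<open>Primality is multiplicativity of \<open>S\<close>. For sums, the product of the two
  witnesses serves as a witness: an element that some member of \<open>S\<close> multiplies into
  \<open>I\<close> cannot lie in \<open>S\<close>.\<close>

lemma prime_in_compl_max_mult_avoiding: "prime_in B (B - S)"
proof -
  have S': "S \<subseteq> B" "1 \<in> S" "x \<in> S \<Longrightarrow> y \<in> S \<Longrightarrow> x * y \<in> S" "S \<inter> I = {}" for x y
    using S by (auto simp: max_mult_avoiding_def mult_avoiding_def)
  note BD = is_subringD[OF B] and ID = ideal_inD[OF I]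
  have *: "x \<notin> S" if "y \<in> S" "x * y \<in> I" for x y using that S'(3,4) by blast
  show ?thesis unfolding prime_in_def
  proof (intro conjI ideal_inI ballI impI)
    fix x y assume xy: "x \<in> B - S" "y \<in> B - S"
    obtain u where u: "u \<in> S" "x * u \<in> I" using max_mult_avoiding_witness[of x] xy by blast
    obtain v where v: "v \<in> S" "y * v \<in> I" using max_mult_avoiding_witness[of y] xy by blast
    have "x * u * v + y * v * u \<in> I"
      by (rule ID(3); rule ID(5)) (use u v S'(1) in auto)
    then have "(x + y) * (u * v) \<in> I" by (simp add: algebra_simps)
    then have "x + y \<notin> S" by (rule *[OF S'(3)[OF u(1) v(1)]])
    then show "x + y \<in> B - S" using xy BD(5) by simp
  next
    fix r x assume rx: "r \<in> B" "x \<in> B - S"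
    obtain u where u: "u \<in> S" "x * u \<in> I" using max_mult_avoiding_witness[of x] rx by blast
    then have "r * x * u \<in> I" using ID(4)[OF rx(1) u(2)] by (simp add: mult.assoc)
    then show "r * x \<in> B - S" using *[OF u(1)] rx BD(6) by simp
  next
    show "0 \<in> B - S" using BD(2) ID(2) S'(4) by blast
    show "1 \<notin> B - S" using S'(2) by simp
    show "B - S \<subseteq> B" by blast
    show "x \<in> B - S \<or> y \<in> B - S" if "x \<in> B" "y \<in> B" "x * y \<in> B - S" for x y
      using that S'(3) by blast
  qed
qed

end

section \<open>Polynomials in countably many variables\<close>

type_synonym 'a poly_var = "(nat \<Rightarrow>\<^sub>0 nat) \<Rightarrow>\<^sub>0 'a"

definition Const :: "'a::comm_ring_1 \<Rightarrow> 'a poly_var" where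
  "Const c = Poly_Mapping.single 0 c"

definition Var :: "nat \<Rightarrow> 'a::comm_ring_1 poly_var" where
  "Var v = Poly_Mapping.single (Poly_Mapping.single v 1) 1"

lemma Const_hom: "comm_ring_hom (Const :: 'a::comm_ring_1 \<Rightarrow> 'a poly_var)"
  by unfold_locales (auto simp: Const_def mult_single single_add)

interpretation Const: comm_ring_hom "Const :: 'a::comm_ring_1 \<Rightarrow> 'a poly_var"
  by (rule Const_hom)

section \<open>Structural induction on polynomials, and subalgebras on sets of variables\<close>

lemma poly_mapping_sum_induct [case_names single add]:
  fixes p :: "'k \<Rightarrow>\<^sub>0 'b::comm_monoid_add"
  assumes "\<And>k c. Q (Poly_Mapping.single k c)" "\<And>p q. Q p \<Longrightarrow> Q q \<Longrightarrow> Q (p + q)"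
  shows "Q p"
proof -
  have "Q (\<Sum>k\<in>A. Poly_Mapping.single k (Poly_Mapping.lookup p k))" if "finite A" for A
    using that
  proof induction
    case empty
    show ?case using assms(1)[of undefined 0] by simp
  qed (simp add: assms)
  moreover have "p = (\<Sum>k\<in>Poly_Mapping.keys p. Poly_Mapping.single k (Poly_Mapping.lookup p k))"
    by (rule poly_mapping_eqI)
      (auto simp: lookup_sum lookup_single when_def in_keys_iff)
  ultimately show ?thesis using finite_keys by metis
qed

text \<open>The subalgebra generated by the variables in \<open>V\<close>; the inductive form lets
  homomorphisms and derivations be compared by rule induction.\<close>

inductive_set polys_in :: "nat set \<Rightarrow> 'a::comm_ring_1 poly_var set" for V where
  Const: "Const c \<in> polys_in V"
| Var: "v \<in> V \<Longrightarrow> Var v \<in> polys_in V"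
| add: "p \<in> polys_in V \<Longrightarrow> q \<in> polys_in V \<Longrightarrow> p + q \<in> polys_in V"
| mult: "p \<in> polys_in V \<Longrightarrow> q \<in> polys_in V \<Longrightarrow> p * q \<in> polys_in V"

lemma is_subring_polys_in: "is_subring (polys_in V)"
proof -
  have "p - q \<in> polys_in V" if "p \<in> polys_in V" "q \<in> polys_in V" for p q :: "'a poly_var"
    using polys_in.add[OF that(1) polys_in.mult[OF polys_in.Const[of "-1"] that(2)]]
    by (simp add: hom_distribs)
  then show ?thesis
    using polys_in.Const[of 1 V] by (auto simp: is_subring_def intro: polys_in.intros)
qed

lemmas polys_in_closed = is_subringD[OF is_subring_polys_in]

lemma polys_in_mono: "V \<subseteq> W \<Longrightarrow> polys_in V \<subseteq> polys_in W"
proof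
  fix p :: "'a poly_var" assume "p \<in> polys_in V" "V \<subseteq> W"
  then show "p \<in> polys_in W" by induction (auto intro: polys_in.intros)
qed

lemma polys_in_UNIV: "p \<in> polys_in UNIV"
proof (induction p rule: poly_mapping_sum_induct)
  case (single m c)
  have mono: "Poly_Mapping.single m (1::'a) \<in> polys_in UNIV" for m
  proof (induction m rule: poly_mapping_sum_induct)
    case (single v n)
    have "Poly_Mapping.single (Poly_Mapping.single v n) (1::'a) = Var v ^ n"
    proof (induction n)
      case (Suc n)
      have "Var v ^ Suc n = Var v * Poly_Mapping.single (Poly_Mapping.single v n) (1::'a)"
        using Suc by simp
      also have "\<dots> = Poly_Mapping.single (Poly_Mapping.single v (Suc n)) 1"
        by (simp add: Var_def mult_single flip: single_add)
      finally show ?case by simp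
    qed simp
    then show ?case by (auto intro: polys_in_closed polys_in.intros)
  next
    case (add m n)
    then show ?case using polys_in.mult[OF add] by (simp add: mult_single)
  qed
  have "Poly_Mapping.single m c = Const c * Poly_Mapping.single m 1"
    by (simp add: Const_def mult_single)
  then show ?case using mono by (auto intro: polys_in.intros)
qed (auto intro: polys_in.intros)

lemma poly_var_induct [case_names Const Var add mult]:
  fixes p :: "'a::comm_ring_1 poly_var"
  assumes "\<And>c. Q (Const c)" "\<And>v. Q (Var v)"
    "\<And>p q. Q p \<Longrightarrow> Q q \<Longrightarrow> Q (p + q)" "\<And>p q. Q p \<Longrightarrow> Q q \<Longrightarrow> Q (p * q)"
  shows "Q p"
  using polys_in_UNIV[of p] by induction (use assms in auto)

text \<open>A polynomial involves only finitely many variables; this is why the levels of the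
  filtration exhaust the ring.\<close>

lemma polys_in_upto: "\<exists>n. p \<in> polys_in {..<n::nat}"
proof (induction p rule: poly_var_induct)
  case (Var v)
  show ?case by (intro exI[of _ "Suc v"] polys_in.intros) simp
next
  case (add p q)
  then obtain m n where "p \<in> polys_in {..<m}" "q \<in> polys_in {..<n}" by blast
  then have "p \<in> polys_in {..<max m n}" "q \<in> polys_in {..<max m n}"
    using polys_in_mono[of "{..<m}" "{..<max m n}"] polys_in_mono[of "{..<n}" "{..<max m n}"] by auto
  then show ?case by (auto intro: polys_in.intros)
next
  case (mult p q)
  then obtain m n where "p \<in> polys_in {..<m}" "q \<in> polys_in {..<n}" by blast
  then have "p \<in> polys_in {..<max m n}" "q \<in> polys_in {..<max m n}"
    using polys_in_mono[of "{..<m}" "{..<max m n}"] polys_in_mono[of "{..<n}" "{..<max m n}"] by auto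
  then show ?case by (auto intro: polys_in.intros)
qed (auto intro: polys_in.intros)

subsection \<open>Evaluation\<close>

definition eval_monom :: "(nat \<Rightarrow> 'b::comm_ring_1) \<Rightarrow> (nat \<Rightarrow>\<^sub>0 nat) \<Rightarrow> 'b" where
  "eval_monom a m = (\<Prod>v\<in>Poly_Mapping.keys m. a v ^ Poly_Mapping.lookup m v)"

definition eval_poly :: "('a::comm_ring_1 \<Rightarrow> 'b::comm_ring_1) \<Rightarrow> (nat \<Rightarrow> 'b) \<Rightarrow> 'a poly_var \<Rightarrow> 'b" where
  "eval_poly h a p = (\<Sum>m\<in>Poly_Mapping.keys p. h (Poly_Mapping.lookup p m) * eval_monom a m)"

lemma eval_monom_superset:
  "finite V \<Longrightarrow> Poly_Mapping.keys m \<subseteq> V \<Longrightarrow> eval_monom a m = (\<Prod>v\<in>V. a v ^ Poly_Mapping.lookup m v)"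
  unfolding eval_monom_def by (rule prod.mono_neutral_left) (auto simp: in_keys_iff)

lemma eval_monom_add: "eval_monom a (m + n) = eval_monom a m * eval_monom a n"
proof -
  have "Poly_Mapping.keys (m + n) \<subseteq> Poly_Mapping.keys m \<union> Poly_Mapping.keys n"
    by (rule keys_add)
  then show ?thesis
    by (subst (1 2 3) eval_monom_superset[of "Poly_Mapping.keys m \<union> Poly_Mapping.keys n"])
      (auto simp: lookup_add power_add prod.distrib)
qed

lemma eval_poly_hom:
  assumes "comm_ring_hom h"
  shows "comm_ring_hom (eval_poly h a)"
    and "eval_poly h a (Const c) = h c" and "eval_poly h a (Var v) = a v"
proof -
  interpret h: comm_ring_hom h by fact
  have single: "eval_poly h a (Poly_Mapping.single m c) = h c * eval_monom a m" for m c
    by (cases "c = 0") (simp_all add: eval_poly_def)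
  have superset: "eval_poly h a p = (\<Sum>m\<in>M. h (Poly_Mapping.lookup p m) * eval_monom a m)"
    if "finite M" "Poly_Mapping.keys p \<subseteq> M" for p M
    unfolding eval_poly_def by (rule sum.mono_neutral_left) (use that in \<open>auto simp: in_keys_iff\<close>)
  have add: "eval_poly h a (p + q) = eval_poly h a p + eval_poly h a q" for p q
  proof -
    have "Poly_Mapping.keys (p + q) \<subseteq> Poly_Mapping.keys p \<union> Poly_Mapping.keys q"
      by (rule keys_add)
    then show ?thesis
      by (subst (1 2 3) superset[of "Poly_Mapping.keys p \<union> Poly_Mapping.keys q"])
        (auto simp: lookup_add h.hom_add distrib_right sum.distrib)
  qed
  \<comment> \<open>Multiplicativity is shown with a monomial on the left and then extended by
    additivity, so the support of a general product never enters.\<close>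
  have "eval_poly h a (Poly_Mapping.single m c * q) = eval_poly h a (Poly_Mapping.single m c) * eval_poly h a q" for m c q
    by (induction q rule: poly_mapping_sum_induct)
      (simp_all add: mult_single single eval_monom_add h.hom_mult add distrib_left distrib_right mult_ac)
  then have mult: "eval_poly h a (p * q) = eval_poly h a p * eval_poly h a q" for p q
    by (induction p rule: poly_mapping_sum_induct) (simp_all add: add distrib_right)
  show const: "eval_poly h a (Const c) = h c" for c
    by (simp add: Const_def single eval_monom_def)
  show "eval_poly h a (Var v) = a v"
    by (simp add: Var_def single eval_monom_def)
  show "comm_ring_hom (eval_poly h a)"
    using const[of 0] const[of 1] by unfold_locales (simp_all add: add mult)
qed

subsection \<open>Derivations\<close>

locale derivation =
  fixes D :: "'r::comm_ring_1 \<Rightarrow> 'r"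
  assumes add: "D (x + y) = D x + D y"
    and mult: "D (x * y) = D x * y + x * D y"
begin

lemma one: "D 1 = 0"
  using mult[of 1 1] by simp

lemma zero: "D 0 = 0"
  using add[of 0 0] by simp

lemma minus: "D (- x) = - D x"
  using add[of x "- x"] by (simp add: zero eq_neg_iff_add_eq_0 add.commute)

lemma diff: "D (x - y) = D x - D y"
  using add[of x "- y"] by (simp add: minus)

end

text \<open>Ring homomorphisms into the dual numbers encode derivations.\<close>

datatype 'r dual = Dual (re: 'r) (eps: 'r)

instantiation dual :: (comm_ring_1) comm_ring_1
begin

definition "0 = Dual 0 0"
definition "1 = Dual 1 0"
definition "x + y = Dual (re x + re y) (eps x + eps y)"
definition "x - y = Dual (re x - re y) (eps x - eps y)"
definition "- x = Dual (- re x) (- eps x)"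
definition "x * y = Dual (re x * re y) (eps x * re y + re x * eps y)"

instance
  by standard (auto simp: zero_dual_def one_dual_def plus_dual_def minus_dual_def uminus_dual_def
      times_dual_def algebra_simps dual.expand)

end

lemma dual_simps [simp]:
  "re 0 = 0" "eps 0 = 0" "re 1 = 1" "eps 1 = 0"
  "re (x + y) = re x + re y" "eps (x + y) = eps x + eps y"
  "re (x * y) = re x * re y" "eps (x * y) = eps x * re y + re x * eps y"
  by (simp_all add: zero_dual_def one_dual_def plus_dual_def times_dual_def)

text \<open>The values prescribed on constants and variables define a homomorphism
  \<open>\<phi>\<close> to the dual numbers. Its first component is the identity, so
  multiplicativity of \<open>\<phi>\<close> is the Leibniz rule for the second.\<close>

lemma derivation_exists:
  fixes d :: "'a::comm_ring_1 \<Rightarrow> 'a" and a :: "nat \<Rightarrow> 'a poly_var"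
  assumes "derivation d"
  obtains D where "derivation D" "\<And>c. D (Const c) = Const (d c)" "\<And>v. D (Var v) = a v"
proof -
  interpret d: derivation d by fact
  define h where "h c = Dual (Const c) (Const (d c))" for c
  have h: "comm_ring_hom h"
    by unfold_locales
      (simp_all add: h_def dual.expand dual_simps d.add d.mult d.one d.zero hom_distribs
        zero_dual_def one_dual_def plus_dual_def times_dual_def)
  define \<phi> where "\<phi> = eval_poly h (\<lambda>v. Dual (Var v) (a v))"
  note \<phi> = eval_poly_hom[OF h, where a = "\<lambda>v. Dual (Var v) (a v)", folded \<phi>_def]
  interpret \<phi>: comm_ring_hom \<phi> by (rule \<phi>(1))
  have re: "re (\<phi> p) = p" for p
    by (induction p rule: poly_var_induct) (simp_all add: \<phi> h_def \<phi>.hom_add \<phi>.hom_mult)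
  show ?thesis
  proof (rule that[of "\<lambda>p. eps (\<phi> p)"])
    show "derivation (\<lambda>p. eps (\<phi> p))"
      by unfold_locales (simp_all add: \<phi>.hom_add \<phi>.hom_mult re)
  qed (simp_all add: \<phi> h_def)
qed

lemma polys_in_derivation_closed:
  assumes "derivation D" "p \<in> polys_in V" "V \<subseteq> W"
    "\<And>c. D (Const c) \<in> polys_in W" "\<And>v. v \<in> V \<Longrightarrow> D (Var v) \<in> polys_in W"
  shows "D p \<in> polys_in W"
proof -
  interpret derivation D by fact
  show ?thesis using assms(2)
    by induction
      (use assms(4,5) polys_in_mono[OF assms(3)] in \<open>auto simp: add mult intro!: polys_in.add polys_in.mult\<close>)
qed

lemma derivation_combine:
  assumes "derivation D" "derivation E"
  shows "derivation (\<lambda>x. a * D x - b * E x)"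
proof -
  interpret D: derivation D by fact
  interpret E: derivation E by fact
  show ?thesis by unfold_locales (simp_all add: D.add D.mult E.add E.mult algebra_simps)
qed

section \<open>Extending derivations in characteristic zero\<close>

text \<open>Views a polynomial as univariate in its last variable, because derivations are extended
  one variable at a time.\<close>

lemma polys_in_Suc_as_poly:
  assumes "p \<in> polys_in {..<Suc k}"
  obtains G where "\<And>i. coeff G i \<in> polys_in {..<k}" "p = poly G (Var k)"
proof -
  let ?C = "polys_in {..<k}"
  have pCons0: "coeff [:p:] i \<in> ?C" if "p \<in> ?C" for p i
    using that by (cases i) (simp_all add: polys_in_closed(2))
  have "\<exists>G. (\<forall>i. coeff G i \<in> ?C) \<and> p = poly G (Var k)"
    using assms
  proof induction
    case (Const c)
    show ?case using pCons0[OF polys_in.Const] by (intro exI[of _ "[:Const c:]"] conjI allI) simp_all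
  next
    case (Var v)
    show ?case
    proof (cases "v = k")
      case True
      have "coeff [:0, 1:] i \<in> ?C" for i
        by (simp add: coeff_pCons polys_in_closed(1,2) split: nat.split)
      with True show ?thesis by (intro exI[of _ "[:0, 1:]"] conjI allI) simp_all
    next
      case False
      with Var have "Var v \<in> ?C" by (intro polys_in.Var) auto
      then show ?thesis using pCons0 by (intro exI[of _ "[:Var v:]"] conjI allI) simp_all
    qed
  next
    case (add p q)
    then obtain G H where GH: "\<And>i. coeff G i \<in> ?C" "p = poly G (Var k)" "\<And>i. coeff H i \<in> ?C" "q = poly H (Var k)"
      by blast
    then show ?case by (intro exI[of _ "G + H"]) (simp add: polys_in.add)
  next
    case (mult p q)
    then obtain G H where GH: "\<And>i. coeff G i \<in> ?C" "p = poly G (Var k)" "\<And>i. coeff H i \<in> ?C" "q = poly H (Var k)"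
      by blast
    have "sum f A \<in> ?C" if "\<And>i. f i \<in> ?C" for f and A :: "nat set"
      by (induction A rule: infinite_finite_induct) (simp_all add: that polys_in_closed(2) polys_in.add)
    note sum_C = this
    have "coeff (G * H) i \<in> ?C" for i
      unfolding coeff_mult by (intro sum_C polys_in.mult GH)
    with GH(2,4) show ?case by (intro exI[of _ "G * H"]) simp
  qed
  then show ?thesis using that by blast
qed

lemma prime_inD:
  assumes "prime_in B P"
  shows "x \<in> P \<Longrightarrow> x \<in> B" "0 \<in> P" "x \<in> P \<Longrightarrow> y \<in> P \<Longrightarrow> x + y \<in> P"
    "r \<in> B \<Longrightarrow> x \<in> P \<Longrightarrow> r * x \<in> P" "x \<in> P \<Longrightarrow> r \<in> B \<Longrightarrow> x * r \<in> P" "1 \<notin> P"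
    "x * y \<in> P \<Longrightarrow> x \<in> B \<Longrightarrow> y \<in> B \<Longrightarrow> x \<notin> P \<Longrightarrow> y \<in> P"
  using assms ideal_inD[of B P] by (auto simp: prime_in_def)

text \<open>The chain rule without its coefficient term; it is applied to the partial derivative
  with respect to one variable.\<close>

lemma derivation_poly_eq_pderiv:
  fixes D :: "'r::idom \<Rightarrow> 'r"
  assumes "derivation D"
  assumes "\<And>i. D (coeff G i) = 0" "D x = 1"
  shows "D (poly G x) = poly (pderiv G) x"
  using assms(2)
proof (induction G)
  interpret derivation D by fact
  case (pCons a G)
  have "D a = 0" "\<And>i. D (coeff G i) = 0"
    using pCons.prems[of 0] pCons.prems[of "Suc _"] by (simp_all add: coeff_pCons)
  then show ?case
    by (simp add: add mult pderiv_pCons pCons.IH assms(3))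
qed (simp add: derivation.zero[OF assms(1)])

text \<open>Both memberships go through one induction because the Leibniz rule for
  \<open>x * poly G x\<close> mixes them.\<close>

lemma (in derivation) poly_in_ideal:
  assumes "is_subring B" "ideal_in B I" "x \<in> B" "D x \<in> B"
    and "\<And>i. coeff G i \<in> I" "\<And>i. D (coeff G i) \<in> I"
  shows "poly G x \<in> I \<and> D (poly G x) \<in> I"
  using assms(5,6)
proof (induction G)
  case (pCons a G)
  have "a \<in> I" "D a \<in> I" "\<And>i. coeff G i \<in> I" "\<And>i. D (coeff G i) \<in> I"
    using pCons.prems[of 0] pCons.prems(1)[of "Suc _"] pCons.prems(2)[of "Suc _"] by (simp_all add: coeff_pCons)
  moreover from this have "poly G x \<in> I" "D (poly G x) \<in> I" using pCons.IH by auto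
  ultimately show ?case
    using assms(3,4) by (simp add: add mult ideal_inD(3-5)[OF assms(2)])
qed (simp add: zero ideal_inD[OF assms(2)])

text \<open>Modulo \<open>P\<close>, \<open>Var k\<close> is either transcendental over the lower
  variables, so that any value of the derivation there is allowed, or algebraic, so that the value
  is forced by a minimal polynomial \<open>G\<close> as a fraction with denominator
  \<open>G'(Var k)\<close>. The multiplier \<open>c\<close> clears this denominator.\<close>

lemma derivation_extend_step:
  fixes D :: "'a::field_char_0 poly_var \<Rightarrow> 'a poly_var"
  assumes D: "derivation D" "\<And>x. x \<in> polys_in {..<b} \<Longrightarrow> D x \<in> polys_in {..<b}"
    and P: "prime_in (polys_in {..<b}) P" and k: "k < b"
    and DP: "\<And>x. x \<in> P \<Longrightarrow> x \<in> polys_in {..<k} \<Longrightarrow> D x \<in> P"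
  obtains D' c where "derivation D'" "\<And>x. x \<in> polys_in {..<b} \<Longrightarrow> D' x \<in> polys_in {..<b}"
    "c \<in> polys_in {..<b}" "c \<notin> P" "\<And>x. x \<in> polys_in {..<k} \<Longrightarrow> D' x = c * D x"
    "\<And>x. x \<in> P \<Longrightarrow> x \<in> polys_in {..<Suc k} \<Longrightarrow> D' x \<in> P"
proof -
  interpret D: derivation D by fact
  let ?B = "polys_in {..<b} :: 'a poly_var set" and ?C = "polys_in {..<k} :: 'a poly_var set"
  let ?x = "Var k :: 'a poly_var"
  note PD = prime_inD[OF P]
  have ideal: "ideal_in ?B P" using P by (simp add: prime_in_def)
  have CB: "x \<in> ?B" if "x \<in> ?C" for x using polys_in_mono[of "{..<k}" "{..<b}"] that k by auto
  have xB: "?x \<in> ?B" using k by (intro polys_in.Var) auto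
  have polyB: "poly G ?x \<in> ?B" if "\<And>i. coeff G i \<in> ?C" for G
    using that
  proof (induction G)
    case (pCons a G)
    have "a \<in> ?C" "\<And>i. coeff G i \<in> ?C"
      using pCons.prems[of 0] pCons.prems[of "Suc _"] by (simp_all add: coeff_pCons)
    then show ?case using pCons.IH CB xB by (auto intro: polys_in.intros)
  qed (simp add: polys_in_closed)
  \<comment> \<open>The algebraic relations of \<open>Var k\<close> modulo \<open>P\<close> over the
    lower variables.\<close>
  define \<G> where "\<G> = {G. (\<forall>i. coeff G i \<in> ?C) \<and> poly G ?x \<in> P}"
  have coeffs_in_P: "D' (poly G ?x) \<in> P"
    if "derivation D'" "\<And>x. x \<in> ?B \<Longrightarrow> D' x \<in> ?B" "\<And>x. x \<in> P \<Longrightarrow> x \<in> ?C \<Longrightarrow> D' x \<in> P"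
      "\<And>i. coeff G i \<in> ?C" "\<And>i. coeff G i \<in> P" for D' G
    using derivation.poly_in_ideal[OF that(1) is_subring_polys_in ideal xB that(2)[OF xB] that(5)
        that(3)[OF that(5,4)]] by simp
  show ?thesis
  proof (cases "\<forall>G\<in>\<G>. \<forall>i. coeff G i \<in> P")
    \<comment> \<open>The transcendental case: every relation is trivial coefficient by coefficient,
      so \<open>D\<close> itself works with \<open>c = 1\<close>.\<close>
    case True
    show ?thesis
    proof (rule that[of D 1])
      fix p assume p: "p \<in> P" "p \<in> polys_in {..<Suc k}"
      obtain G where G: "\<And>i. coeff G i \<in> ?C" "p = poly G ?x"
        using polys_in_Suc_as_poly[OF p(2)] by metis
      with p True have "\<And>i. coeff G i \<in> P" by (auto simp: \<G>_def)
      with G(1) show "D p \<in> P" unfolding G(2) by (intro coeffs_in_P[of D] D DP)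
    qed (use D(1) PD(6) in \<open>simp_all add: D(2) polys_in_closed\<close>)
  next
    case False
    \<comment> \<open>The relations that are nontrivial modulo \<open>P\<close>; one of least degree
      is chosen.\<close>
    define Q where "Q G \<longleftrightarrow> G \<in> \<G> \<and> (\<exists>i. coeff G i \<notin> P)" for G
    from False obtain G0 where "Q G0" by (auto simp: Q_def)
    then obtain G where G: "Q G" "\<And>H. Q H \<Longrightarrow> degree G \<le> degree H"
      using ex_has_least_nat[of Q G0 degree] by blast
    text \<open>\<open>G\<close> plays the role of the minimal polynomial of \<open>Var k\<close> over the fraction field of the lower
      variables modulo \<open>P\<close>. Below, \<open>D'\<close> is \<open>D\<close> with the value at \<open>Var k\<close> corrected, after clearing
      denominators, so that \<open>f = G(Var k)\<close> is sent to \<open>0\<close>.\<close>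
    define n l f where "n = degree G" and "l = coeff G n" and "f = poly G ?x"
    have GC: "coeff G i \<in> ?C" for i using G by (auto simp: Q_def \<G>_def)
    have f: "f \<in> P" using G by (auto simp: Q_def \<G>_def f_def)
    have l: "l \<notin> P"
    proof
      assume "l \<in> P"
      obtain i where i: "coeff G i \<notin> P" using G by (auto simp: Q_def)
      then have "i \<noteq> n" using \<open>l \<in> P\<close> by (auto simp: l_def)
      moreover have "i \<le> n" using i PD(2) by (metis coeff_eq_0 linorder_not_le n_def)
      ultimately have "n > 0" by simp
      \<comment> \<open>If the leading coefficient were in \<open>P\<close>, dropping it would leave
        a nontrivial relation of smaller degree.\<close>
      define H where "H = G - monom l n"
      have H: "coeff H j = (if j = n then 0 else coeff G j)" for j
        by (simp add: H_def l_def)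
      have "poly H ?x = f - l * ?x ^ n" by (simp add: H_def f_def poly_monom)
      also have "\<dots> \<in> P"
        using f \<open>l \<in> P\<close> xB by (intro ideal_in_diff[OF is_subring_polys_in ideal] PD(5) polys_in_closed)
      finally have "poly H ?x \<in> P" .
      moreover have "coeff H j \<in> ?C" for j using GC by (simp add: H polys_in_closed(2))
      ultimately have "Q H" using i \<open>i \<noteq> n\<close> by (auto simp: Q_def \<G>_def H intro!: exI[of _ i])
      then have "n \<le> degree H" using G(2) n_def by blast
      moreover have "degree H < n"
      proof (rule ccontr)
        assume "\<not> degree H < n"
        then have "coeff H (degree H) = 0" by (auto simp: H n_def coeff_eq_0)
        then have "H = 0" by simp
        with \<open>\<not> degree H < n\<close> \<open>n > 0\<close> show False by simp
      qed
      ultimately show False by simp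
    qed
    have n: "n > 0"
    proof (rule ccontr)
      assume "\<not> n > 0"
      then have "G = [:l:]" by (simp add: n_def l_def degree_0_id)
      then have "f = l" by (simp add: f_def)
      with f l show False by simp
    qed
    have zero: "derivation (\<lambda>_. 0 :: 'a)" by unfold_locales auto
    \<comment> \<open>\<open>E\<close> is the partial derivative with respect to
      \<open>Var k\<close>.\<close>
    obtain E where E: "derivation E" "\<And>c. E (Const c) = (Const 0 :: 'a poly_var)"
      "\<And>v. E (Var v) = (if v = k then 1 else 0)"
      by (rule derivation_exists[OF zero, where a = "\<lambda>v. if v = k then 1 else 0"]) (rule that; assumption)
    interpret E: derivation E by fact
    have E0: "E x = 0" if "x \<in> ?C" for x
      using that by induction (simp_all add: E E.add E.mult)
    have EB: "E x \<in> ?B" if "x \<in> ?B" for x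
      by (rule polys_in_derivation_closed[OF E(1) that]) (simp_all add: E(2,3) polys_in.Const polys_in_closed(1,2))
    define f' where "f' = E f"
    have f': "f' = poly (pderiv G) ?x"
      unfolding f'_def f_def by (rule derivation_poly_eq_pderiv[OF E(1)]) (simp_all add: E0 GC E(3))
    have f'B: "f' \<in> ?B" using EB PD(1) f by (simp add: f'_def)
    \<comment> \<open>Separability: otherwise \<open>pderiv G\<close> would be a relation of smaller
      degree, nontrivial because its coefficient \<open>n * l\<close> is outside \<open>P\<close>,
      \<open>n\<close> being invertible in characteristic zero.\<close>
    have "f' \<notin> P"
    proof
      assume "f' \<in> P"
      have nat_C: "of_nat j \<in> ?C" for j by (metis Const.hom_of_nat polys_in.Const)
      have "coeff (pderiv G) i \<in> ?C" for i
        unfolding coeff_pderiv by (intro polys_in.mult nat_C GC)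
      then have "pderiv G \<in> \<G>" using \<open>f' \<in> P\<close> f' by (auto simp: \<G>_def)
      moreover have "coeff (pderiv G) (n - 1) \<notin> P"
      proof
        assume "coeff (pderiv G) (n - 1) \<in> P"
        moreover have "coeff (pderiv G) (n - 1) = of_nat n * l" using n by (simp add: coeff_pderiv l_def)
        ultimately have "of_nat n * l \<in> P" by simp
        then have "Const (1 / of_nat n) * (of_nat n * l) \<in> P" by (rule PD(4)[OF polys_in.Const])
        moreover have "Const (1 / of_nat n) * (of_nat n * l) = Const (1 / of_nat n * of_nat n) * l"
          by (simp only: Const.hom_mult Const.hom_of_nat mult.assoc)
        moreover have "1 / of_nat n * of_nat n = (1::'a)" using n by simp
        ultimately show False using l by simp
      qed
      ultimately have "Q (pderiv G)" by (auto simp: Q_def)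
      then have "n \<le> degree (pderiv G)" using G(2) n_def by blast
      with n show False by (simp add: degree_pderiv n_def)
    qed
    define D' where "D' x = f' * D x - D f * E x" for x
    have D': "derivation D'" unfolding D'_def by (rule derivation_combine[OF D(1) E(1)])
    interpret D': derivation D' by fact
    have D'f: "D' f = 0" by (simp add: D'_def f'_def mult.commute)
    have D'C: "D' x = f' * D x" if "x \<in> ?C" for x using E0[OF that] by (simp add: D'_def)
    have D'B: "D' x \<in> ?B" if "x \<in> ?B" for x
      unfolding D'_def using that f'B EB D(2) PD(1)[OF f] by (intro polys_in_closed) auto
    have D'P: "D' x \<in> P" if "x \<in> P" "x \<in> ?C" for x
      using D'C DP that f'B PD(4) by simp
    \<comment> \<open>Pseudo-division by \<open>G\<close>: \<open>l * H\<close> minus a suitable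
      multiple of \<open>G\<close> has smaller degree than \<open>H\<close>. The subtracted term is
      harmless since \<open>f \<in> P\<close> and \<open>D' f = 0\<close>, and
      \<open>l \<notin> P\<close> can be cancelled because \<open>P\<close> is prime.\<close>
    have main: "D' (poly H ?x) \<in> P" if "\<And>i. coeff H i \<in> ?C" "poly H ?x \<in> P" for H
      using that
    proof (induction "degree H" arbitrary: H rule: less_induct)
      case (less H)
      note HC = less.prems(1)
      show ?case
      proof (cases "\<forall>i. coeff H i \<in> P")
        case True
        with HC show ?thesis by (intro coeffs_in_P[of D'] D' D'B D'P) auto
      next
        case False
        define m h where "m = degree H" and "h = coeff H m"
        have "Q H" using False less.prems by (auto simp: Q_def \<G>_def)
        then have "n \<le> m" using G(2) by (simp add: n_def m_def)
        define u where "u = h * ?x ^ (m - n)"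
        define K where "K = smult l H - smult h (monom 1 (m - n) * G)"
        have K: "coeff K i = l * coeff H i - h * (if m - n \<le> i then coeff G (i - (m - n)) else 0)" for i
          by (simp add: K_def coeff_monom_mult)
        have KC: "coeff K i \<in> ?C" for i
          unfolding K l_def h_def using HC GC by (auto intro!: polys_in_closed)
        have polyK: "poly K ?x = l * poly H ?x - u * f"
          by (simp add: K_def f_def u_def poly_monom mult.assoc)
        have B: "l \<in> ?B" "h \<in> ?B" "u \<in> ?B" "poly H ?x \<in> ?B"
          unfolding u_def using GC HC CB xB polyB by (auto simp: l_def h_def intro!: polys_in_closed)
        have KP: "poly K ?x \<in> P"
          unfolding polyK using B f less.prems by (intro ideal_in_diff[OF is_subring_polys_in ideal] PD(4))
        have "degree K < m"
        proof (rule ccontr)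
          assume *: "\<not> degree K < m"
          have "coeff K i = 0" if "i \<ge> m" for i
          proof (cases "i = m")
            case True
            then show ?thesis using \<open>n \<le> m\<close> by (simp add: K l_def h_def)
          next
            case False
            then show ?thesis using that \<open>n \<le> m\<close> by (simp add: K coeff_eq_0 m_def n_def)
          qed
          then have "coeff K (degree K) = 0" using * by simp
          then have "K = 0" by simp
          with * n \<open>n \<le> m\<close> show False by simp
        qed
        then have "D' (poly K ?x) \<in> P" using less.hyps KC KP by (simp add: m_def)
        moreover have "l * D' (poly H ?x) = D' (poly K ?x) + D' u * f - D' l * poly H ?x"
        proof -
          have "l * poly H ?x = poly K ?x + u * f" by (simp add: polyK)
          then have "D' (l * poly H ?x) = D' (poly K ?x + u * f)" by simp
          then show ?thesis by (simp add: D'.add D'.mult D'f algebra_simps)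
        qed
        ultimately have "l * D' (poly H ?x) \<in> P"
          using f less.prems B D'B
          by (auto intro!: ideal_in_diff[OF is_subring_polys_in ideal] PD(3,4))
        then show ?thesis using PD(7) l B D'B by blast
      qed
    qed
    show ?thesis
    proof (rule that[OF D' D'B f'B \<open>f' \<notin> P\<close> D'C])
      fix p assume p: "p \<in> P" "p \<in> polys_in {..<Suc k}"
      obtain G where G: "\<And>i. coeff G i \<in> ?C" "p = poly G ?x"
        using polys_in_Suc_as_poly[OF p(2)] by metis
      with p main[of G] show "D' p \<in> P" by simp
    qed
  qed
qed

text \<open>Iterates the one-variable step from \<open>a\<close> to \<open>b\<close>. The
  multipliers accumulate to a product that stays outside the prime \<open>P\<close>; in effect
  \<open>D' / c\<close> is the derivation induced on the fraction field of the residue ring.\<close>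

lemma derivation_extend:
  fixes D :: "'a::field_char_0 poly_var \<Rightarrow> 'a poly_var"
  assumes D: "derivation D" "\<And>x. x \<in> polys_in {..<b} \<Longrightarrow> D x \<in> polys_in {..<b}"
    and P: "prime_in (polys_in {..<b}) P" and "a \<le> b"
    and DP: "\<And>x. x \<in> P \<Longrightarrow> x \<in> polys_in {..<a} \<Longrightarrow> D x \<in> P"
  obtains D' c where "derivation D'" "\<And>x. x \<in> polys_in {..<b} \<Longrightarrow> D' x \<in> polys_in {..<b}"
    "c \<in> polys_in {..<b}" "c \<notin> P" "\<And>x. x \<in> polys_in {..<a} \<Longrightarrow> D' x = c * D x"
    "\<And>x. x \<in> P \<Longrightarrow> D' x \<in> P"
proof -
  let ?B = "polys_in {..<b} :: 'a poly_var set"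
  note PD = prime_inD[OF P]
  have "\<exists>D' c. derivation D' \<and> (\<forall>x\<in>?B. D' x \<in> ?B) \<and> c \<in> ?B \<and> c \<notin> P \<and>
    (\<forall>x\<in>polys_in {..<a}. D' x = c * D x) \<and> (\<forall>x\<in>P \<inter> polys_in {..<k}. D' x \<in> P)"
    if "a \<le> k" "k \<le> b" for k
    using that
  proof (induction k rule: dec_induct)
    case base
    show ?case
      by (rule exI[of _ D], rule exI[of _ 1]) (use D(1) DP PD(6) in \<open>simp add: D(2) polys_in_closed\<close>)
  next
    case (step k)
    then obtain E c where E: "derivation E" "\<forall>x\<in>?B. E x \<in> ?B" "c \<in> ?B" "c \<notin> P"
      "\<forall>x\<in>polys_in {..<a}. E x = c * D x" "\<forall>x\<in>P \<inter> polys_in {..<k}. E x \<in> P" by auto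
    obtain D' c' where D': "derivation D'" "\<And>x. x \<in> ?B \<Longrightarrow> D' x \<in> ?B" "c' \<in> ?B" "c' \<notin> P"
      "\<And>x. x \<in> polys_in {..<k} \<Longrightarrow> D' x = c' * E x" "\<And>x. x \<in> P \<Longrightarrow> x \<in> polys_in {..<Suc k} \<Longrightarrow> D' x \<in> P"
      by (rule derivation_extend_step[OF E(1) _ P, of k]) (use E(2,6) step.prems in auto)
    have "D' x = c' * c * D x" if "x \<in> polys_in {..<a}" for x
      using that D'(5)[of x] E(5) polys_in_mono[of "{..<a}" "{..<k}"] step.hyps by (auto simp: mult.assoc)
    moreover have "c' * c \<in> ?B" "c' * c \<notin> P"
      using D'(3,4) E(3,4) PD(7) polys_in.mult by blast+
    ultimately show ?case using D'(1,2,6) by (intro exI[of _ D'] exI[of _ "c' * c"]) blast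
  qed
  from this[OF \<open>a \<le> b\<close> order.refl] obtain D' c where "derivation D'" "\<forall>x\<in>?B. D' x \<in> ?B" "c \<in> ?B" "c \<notin> P"
    "\<forall>x\<in>polys_in {..<a}. D' x = c * D x" "\<forall>x\<in>P \<inter> polys_in {..<b}. D' x \<in> P" by blast
  then show ?thesis using PD(1) by (intro that[of D' c]) blast+
qed

section \<open>Towers of maximal invariant ideals\<close>

text \<open>The first \<open>N\<close> variables are the indeterminates and adding \<open>N\<close>
  to an index differentiates. Polynomials in the first \<open>N * i\<close> variables are thus those
  in derivatives of order less than \<open>i\<close>; for \<open>i = 0\<close> these are the
  constants.\<close>

locale prolongation =
  fixes d :: "'a::field_char_0 \<Rightarrow> 'a" and N :: nat
    and \<Delta> s :: "'a poly_var \<Rightarrow> 'a poly_var"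
  assumes N: "N > 0"
    and d: "derivation d"
    and derivation: "derivation \<Delta>"
    and \<Delta>_Const: "\<Delta> (Const c) = Const (d c)"
    and \<Delta>_Var: "\<Delta> (Var v) = Var (v + N)"
    and s: "comm_ring_hom s"
    and s_\<Delta>: "s (\<Delta> p) = \<Delta> (s p)"
    and s_level: "p \<in> polys_in {..<N * i} \<Longrightarrow> s p \<in> polys_in {..<N * i}"
begin

sublocale \<Delta>: derivation \<Delta> by (rule derivation)
sublocale s: comm_ring_hom s by (rule s)

abbreviation level :: "nat \<Rightarrow> 'a poly_var set" where
  "level i \<equiv> polys_in {..<N * i}"

lemma level_mono: "i \<le> j \<Longrightarrow> level i \<subseteq> level j"
  by (intro polys_in_mono) auto

lemma \<Delta>_level: "p \<in> level i \<Longrightarrow> \<Delta> p \<in> level (Suc i)"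
  by (rule polys_in_derivation_closed[OF derivation])
    (auto simp: \<Delta>_Const \<Delta>_Var intro: polys_in.intros)

text \<open>No residue ring is formed: the homomorphism takes values in the fractions of the whole
  polynomial ring, and instead of its kernel one takes the elements whose value lies in
  \<open>P\<close> up to a power of \<open>c\<close>.\<close>

lemma proper_prolongation:
  assumes m: "max_inv_ideal s (level i) m" and n: "max_inv_ideal s (level (Suc i)) n"
    and mn: "m \<subseteq> n" "\<Delta> ` m \<subseteq> n"
  shows "\<exists>I. ideal_in (level (Suc (Suc i))) I \<and> n \<subseteq> I \<and> \<Delta> ` n \<subseteq> I \<and> 1 \<notin> I"
proof -
  \<comment> \<open>\<open>a\<close> and \<open>b\<close> count the variables of levels
    \<open>i\<close> and \<open>i + 1\<close>; \<open>n\<close> lives in \<open>b\<close> variables,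
    its derivatives in \<open>b + N\<close>.\<close>
  define a b where "a = N * i" and "b = N * Suc i"
  have b: "b = a + N" and "a \<le> b" by (simp_all add: a_def b_def)
  let ?A = "polys_in {..<a} :: 'a poly_var set" and ?B = "polys_in {..<b} :: 'a poly_var set"
    and ?C = "polys_in {..<b + N} :: 'a poly_var set"
  have levels: "level i = ?A" "level (Suc i) = ?B" "level (Suc (Suc i)) = ?C"
    by (simp_all add: a_def b_def add.commute)
  note m = m[unfolded levels] and n = n[unfolded levels]
  have sA: "s ` ?A \<subseteq> ?A" and sB: "s ` ?B \<subseteq> ?B" using s_level unfolding a_def b_def by blast+
  have AB: "?A \<subseteq> ?B" using polys_in_mono[of "{..<a}" "{..<b}"] \<open>a \<le> b\<close> by auto
  have BC: "?B \<subseteq> ?C" using polys_in_mono[of "{..<b}" "{..<b + N}"] by auto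
  have m_ideal: "ideal_in ?A m" and n_ideal: "ideal_in ?B n" using m n max_inv_idealD(1) by blast+
  note mI = ideal_inD[OF m_ideal] and nI = ideal_inD[OF n_ideal]
  have nA: "n \<inter> ?A = m"
    by (rule max_inv_ideal_restrict[OF m n is_subring_polys_in AB sA mn(1)])
  \<comment> \<open>\<open>S\<close> is chosen maximal below and then enlarged to \<open>T\<close>,
    which is possible because \<open>n \<inter> ?A = m\<close>. Maximality of \<open>S\<close> gives
    \<open>T \<inter> ?A = S\<close>, so the prime \<open>?B - T\<close> restricts to
    \<open>?A - S\<close>.\<close>
  have "mult_avoiding ?A m {1}"
    using max_inv_idealD(3)[OF m] by (auto simp: mult_avoiding_def polys_in_closed(1))
  then obtain S where S: "max_mult_avoiding ?A m S" using max_mult_avoiding_exists by metis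
  have S': "S \<subseteq> ?A" "mult_avoiding ?A m S" using S by (auto simp: max_mult_avoiding_def mult_avoiding_def)
  have "mult_avoiding ?B n S" using S' AB nA unfolding mult_avoiding_def by blast
  then obtain T where ST: "S \<subseteq> T" and T: "max_mult_avoiding ?B n T" using max_mult_avoiding_exists by metis
  have T': "T \<subseteq> ?B" "1 \<in> T" "\<And>x y. x \<in> T \<Longrightarrow> y \<in> T \<Longrightarrow> x * y \<in> T" "T \<inter> n = {}"
    using T unfolding max_mult_avoiding_def mult_avoiding_def by blast+
  have "mult_avoiding ?A m (T \<inter> ?A)"
    using T' nA by (auto simp: mult_avoiding_def polys_in_closed(1) polys_in.mult)
  moreover have "S \<subseteq> T \<inter> ?A" using ST S' by blast
  ultimately have TA: "T \<inter> ?A = S" using S unfolding max_mult_avoiding_def by blast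
  define P where "P = ?B - T"
  have P: "prime_in ?B P"
    unfolding P_def
    by (rule prime_in_compl_max_mult_avoiding[OF is_subring_polys_in n_ideal _ T])
      (rule max_inv_ideal_radical[OF s n is_subring_polys_in sB])
  note PD = prime_inD[OF P]
  have nP: "n \<subseteq> P" using nI(1) T'(4) by (auto simp: P_def)
  have \<Delta>AB: "\<Delta> x \<in> ?B" if "x \<in> ?A" for x
    using \<Delta>_level[of x i] that by (simp add: a_def b_def)
  text \<open>An element of a minimal prime is killed modulo the ideal by an element outside the prime.\<close>
  have \<Delta>P: "\<Delta> x \<in> P" if x: "x \<in> P" "x \<in> ?A" for x
  proof -
    have "x \<notin> S" using x TA by (auto simp: P_def)
    then obtain y where y: "y \<in> S" "x * y \<in> m"
      using max_mult_avoiding_witness[OF is_subring_polys_in m_ideal _ S x(2)]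
        max_inv_ideal_radical[OF s m is_subring_polys_in sA] by metis
    have yA: "y \<in> ?A" and yT: "y \<in> T" using y(1) S'(1) ST by auto
    have yB: "y \<in> ?B" using yA AB by auto
    have "\<Delta> (x * y) \<in> P" using y(2) mn(2) nP by auto
    then have "\<Delta> x * y + x * \<Delta> y \<in> P" by (simp add: \<Delta>.mult)
    moreover have "x * \<Delta> y \<in> P" using x yA \<Delta>AB PD(5) by blast
    ultimately have "(\<Delta> x * y + x * \<Delta> y) - x * \<Delta> y \<in> P"
      using P by (intro ideal_in_diff[OF is_subring_polys_in, of _ P]) (auto simp: prime_in_def)
    then have "y * \<Delta> x \<in> P" by (simp add: mult.commute)
    moreover have "y \<notin> P" using yT by (simp add: P_def)
    ultimately show "\<Delta> x \<in> P" using PD(7)[OF _ yB \<Delta>AB[OF x(2)]] by blast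
  qed
  \<comment> \<open>\<open>\<Delta>\<close> does not preserve \<open>?B\<close>. \<open>D0\<close>
    agrees with it on \<open>?A\<close> and kills the variables from \<open>a\<close> on, so it maps
    \<open>?B\<close> to itself as \<open>derivation_extend\<close> requires.\<close>
  obtain D0 where D0: "derivation D0" "\<And>c. D0 (Const c) = Const (d c)"
    "\<And>v. D0 (Var v) = (if v < a then Var (v + N) else 0)"
    by (rule derivation_exists[OF d, where a = "\<lambda>v. if v < a then Var (v + N) else 0"]) (rule that; assumption)
  interpret D0: derivation D0 by fact
  have D0A: "D0 x = \<Delta> x" if "x \<in> ?A" for x
    using that by induction (simp_all add: D0(2,3) \<Delta>_Const \<Delta>_Var D0.add D0.mult \<Delta>.add \<Delta>.mult)
  have D0B: "D0 x \<in> ?B" if "x \<in> ?B" for x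
    by (rule polys_in_derivation_closed[OF D0(1) that order.refl])
      (simp_all add: D0(2,3) b polys_in.Const polys_in.Var polys_in_closed(2))
  have D0P: "D0 x \<in> P" if "x \<in> P" "x \<in> ?A" for x using \<Delta>P[OF that] D0A[OF that(2)] by simp
  obtain D c where D: "derivation D" "\<And>x. x \<in> ?B \<Longrightarrow> D x \<in> ?B" "c \<in> ?B" "c \<notin> P"
    "\<And>x. x \<in> ?A \<Longrightarrow> D x = c * D0 x" "\<And>x. x \<in> P \<Longrightarrow> D x \<in> P"
    by (rule derivation_extend[OF D0(1) D0B P \<open>a \<le> b\<close> D0P]) (assumption | rule that; assumption)+
  interpret D: derivation D by fact
  define \<iota> :: "'a poly_var \<Rightarrow> 'a poly_var fract" where "\<iota> = to_fract"
  interpret \<iota>: comm_ring_hom \<iota> unfolding \<iota>_def by unfold_locales simp_all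
  have \<iota>_inj: "\<iota> x = \<iota> y \<longleftrightarrow> x = y" for x y by (simp add: \<iota>_def)
  have "c \<noteq> 0" using D(4) PD(2) by auto
  then have c0: "\<iota> c \<noteq> 0" using \<iota>_inj[of c 0] by simp
  have h: "comm_ring_hom (\<lambda>z. \<iota> (Const z))"
    by unfold_locales (simp_all add: \<iota>.hom_add \<iota>.hom_mult Const.hom_add Const.hom_mult)
  \<comment> \<open>A new variable \<open>v \<ge> b\<close> stands for the derivative of
    \<open>Var (v - N)\<close> and receives the value of \<open>D / c\<close> there.\<close>
  define \<phi> where "\<phi> = eval_poly (\<lambda>z. \<iota> (Const z)) (\<lambda>v. if v < b then \<iota> (Var v) else \<iota> (D (Var (v - N))) / \<iota> c)"
  note \<phi> = eval_poly_hom[OF h, where a = "\<lambda>v. if v < b then \<iota> (Var v) else \<iota> (D (Var (v - N))) / \<iota> c", folded \<phi>_def]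
  interpret \<phi>: comm_ring_hom \<phi> by (rule \<phi>(1))
  have \<phi>B: "\<phi> x = \<iota> x" if "x \<in> ?B" for x
    using that by induction (simp_all add: \<phi>(2,3) \<phi>.hom_add \<phi>.hom_mult \<iota>.hom_add \<iota>.hom_mult)
  \<comment> \<open>On \<open>?B\<close>, \<open>\<phi>\<close> turns \<open>\<Delta>\<close> into
    \<open>D / c\<close>: for variables below \<open>a\<close> because \<open>D = c * D0\<close> on
    \<open>?A\<close>, for the others by the choice of \<open>\<phi>\<close>.\<close>
  have \<phi>\<Delta>: "\<iota> c * \<phi> (\<Delta> x) = \<iota> (D x)" if "x \<in> ?B" for x
    using that
  proof induction
    case (Const z)
    have "D (Const z) = c * Const (d z)" using D(5)[OF polys_in.Const] by (simp add: D0(2))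
    then show ?case by (simp add: \<Delta>_Const \<phi>(2) \<iota>.hom_mult)
  next
    case (Var v)
    show ?case
    proof (cases "v < a")
      case True
      then have "D (Var v) = c * Var (v + N)" using D(5)[of "Var v"] by (simp add: polys_in.Var D0(3))
      moreover have "v + N < b" using True b by simp
      ultimately show ?thesis by (simp add: \<Delta>_Var \<phi>(3) \<iota>.hom_mult)
    next
      case False
      then have "\<not> v + N < b" using b by simp
      then show ?thesis using c0 by (simp add: \<Delta>_Var \<phi>(3))
    qed
  next
    case (add p q)
    then show ?case by (simp add: \<Delta>.add D.add \<phi>.hom_add \<iota>.hom_add distrib_left)
  next
    case (mult p q)
    have "\<iota> c * \<phi> (\<Delta> (p * q)) = (\<iota> c * \<phi> (\<Delta> p)) * \<phi> q + \<phi> p * (\<iota> c * \<phi> (\<Delta> q))"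
      by (simp add: \<Delta>.mult \<phi>.hom_add \<phi>.hom_mult algebra_simps)
    then show ?case using mult by (simp add: \<phi>B D.mult \<iota>.hom_add \<iota>.hom_mult)
  qed
  have cB: "c ^ k \<in> ?B" for k using D(3) polys_in_closed(7) by blast
  \<comment> \<open>\<open>\<phi>\<close> maps \<open>?C\<close> into \<open>?B\<close> with
    \<open>c\<close> inverted; this is what makes \<open>I\<close> closed under multiplication by
    \<open>?C\<close>.\<close>
  have denom: "\<exists>k. \<exists>y\<in>?B. \<iota> (c ^ k) * \<phi> x = \<iota> y" if "x \<in> ?C" for x
    using that
  proof induction
    case (Const z)
    show ?case by (rule exI[of _ 0], rule bexI[of _ "Const z"]) (simp_all add: \<phi>(2) polys_in.Const)
  next
    case (Var v)
    show ?case
    proof (cases "v < b")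
      case True
      then show ?thesis by (intro exI[of _ 0] bexI[of _ "Var v"]) (simp_all add: \<phi>(3) polys_in.Var)
    next
      case False
      then have "Var (v - N) \<in> ?B" using Var N b by (intro polys_in.Var) auto
      then show ?thesis
        using False c0 by (intro exI[of _ 1] bexI[of _ "D (Var (v - N))"]) (simp_all add: \<phi>(3) D(2))
    qed
  next
    case (add p q)
    then obtain k l y z where "y \<in> ?B" "z \<in> ?B" "\<iota> (c ^ k) * \<phi> p = \<iota> y" "\<iota> (c ^ l) * \<phi> q = \<iota> z" by blast
    moreover have "\<iota> (c ^ (k + l)) * \<phi> (p + q) =
        \<iota> (c ^ l) * (\<iota> (c ^ k) * \<phi> p) + \<iota> (c ^ k) * (\<iota> (c ^ l) * \<phi> q)"
      by (simp add: power_add \<iota>.hom_mult \<phi>.hom_add algebra_simps)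
    ultimately have "\<iota> (c ^ (k + l)) * \<phi> (p + q) = \<iota> (c ^ l * y + c ^ k * z)" "c ^ l * y + c ^ k * z \<in> ?B"
      using cB by (simp_all add: \<iota>.hom_mult \<iota>.hom_add polys_in.add polys_in.mult)
    then show ?case by blast
  next
    case (mult p q)
    then obtain k l y z where "y \<in> ?B" "z \<in> ?B" "\<iota> (c ^ k) * \<phi> p = \<iota> y" "\<iota> (c ^ l) * \<phi> q = \<iota> z" by blast
    moreover have "\<iota> (c ^ (k + l)) * \<phi> (p * q) = (\<iota> (c ^ k) * \<phi> p) * (\<iota> (c ^ l) * \<phi> q)"
      by (simp add: power_add \<iota>.hom_mult \<phi>.hom_mult algebra_simps)
    ultimately have "\<iota> (c ^ (k + l)) * \<phi> (p * q) = \<iota> (y * z)" "y * z \<in> ?B"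
      by (simp_all add: \<iota>.hom_mult polys_in.mult)
    then show ?case by blast
  qed
  \<comment> \<open>The preimage of the ideal that \<open>P\<close> generates in
    \<open>?B[1/c]\<close>; it is proper since no power of \<open>c\<close> lies in the prime
    \<open>P\<close>.\<close>
  define I where "I = {x \<in> ?C. \<exists>k. \<exists>y\<in>P. \<iota> (c ^ k) * \<phi> x = \<iota> y}"
  have "ideal_in ?C I"
  proof (rule ideal_inI)
    fix p q assume "p \<in> I" "q \<in> I"
    then obtain k l y z where pq: "p \<in> ?C" "q \<in> ?C" "y \<in> P" "z \<in> P"
      "\<iota> (c ^ k) * \<phi> p = \<iota> y" "\<iota> (c ^ l) * \<phi> q = \<iota> z" unfolding I_def by blast
    have "\<iota> (c ^ (k + l)) * \<phi> (p + q) =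
        \<iota> (c ^ l) * (\<iota> (c ^ k) * \<phi> p) + \<iota> (c ^ k) * (\<iota> (c ^ l) * \<phi> q)"
      by (simp add: power_add \<iota>.hom_mult \<phi>.hom_add algebra_simps)
    then have "\<iota> (c ^ (k + l)) * \<phi> (p + q) = \<iota> (c ^ l * y + c ^ k * z)" "c ^ l * y + c ^ k * z \<in> P"
      using cB pq PD(3,4) by (simp_all add: \<iota>.hom_mult \<iota>.hom_add)
    then show "p + q \<in> I" using pq(1,2) polys_in.add unfolding I_def by blast
  next
    fix r p assume "r \<in> ?C" "p \<in> I"
    then obtain k y l z where rp: "p \<in> ?C" "y \<in> P" "\<iota> (c ^ k) * \<phi> p = \<iota> y" "z \<in> ?B"
      "\<iota> (c ^ l) * \<phi> r = \<iota> z" using denom unfolding I_def by blast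
    have "\<iota> (c ^ (l + k)) * \<phi> (r * p) = (\<iota> (c ^ l) * \<phi> r) * (\<iota> (c ^ k) * \<phi> p)"
      by (simp add: power_add \<iota>.hom_mult \<phi>.hom_mult algebra_simps)
    then have "\<iota> (c ^ (l + k)) * \<phi> (r * p) = \<iota> (z * y)" "z * y \<in> P"
      using rp PD(4) by (simp_all add: \<iota>.hom_mult)
    then show "r * p \<in> I" using rp(1) \<open>r \<in> ?C\<close> polys_in.mult unfolding I_def by blast
  next
    have "\<iota> (c ^ 0) * \<phi> 0 = \<iota> 0" by simp
    then show "0 \<in> I" using PD(2) polys_in_closed(2) unfolding I_def by blast
  qed (auto simp: I_def)
  moreover have "n \<subseteq> I"
  proof
    fix x assume x: "x \<in> n"
    then have "\<iota> (c ^ 0) * \<phi> x = \<iota> x" using \<phi>B[OF nI(1)] by simp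
    then show "x \<in> I" using x nP nI(1) BC unfolding I_def by blast
  qed
  moreover have "\<Delta> ` n \<subseteq> I"
  proof (intro image_subsetI)
    fix x assume x: "x \<in> n"
    have "\<iota> (c ^ 1) * \<phi> (\<Delta> x) = \<iota> (D x)" using \<phi>\<Delta>[OF nI(1)[OF x]] by simp
    moreover have "D x \<in> P" using x nP D(6) by blast
    moreover have "\<Delta> x \<in> ?C" using \<Delta>_level[of x "Suc i"] nI(1)[OF x] by (simp only: levels)
    ultimately show "\<Delta> x \<in> I" unfolding I_def by blast
  qed
  moreover have "1 \<notin> I"
  proof
    assume "1 \<in> I"
    then obtain k y where "y \<in> P" "\<iota> (c ^ k) = \<iota> y" unfolding I_def by auto
    then have "c ^ k \<in> P" by (simp add: \<iota>_inj)
    then show False using prime_in_power[OF P is_subring_polys_in D(3)] D(4) by blast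
  qed
  ultimately show ?thesis unfolding levels by blast
qed

text \<open>The ideal generated by \<open>n\<close> and \<open>\<Delta> n\<close> is proper by
  \<open>proper_prolongation\<close> and stable because \<open>s\<close> commutes with
  \<open>\<Delta>\<close>, so it lies in a maximal one.\<close>

lemma prolongation_step:
  assumes m: "max_inv_ideal s (level i) m" and n: "max_inv_ideal s (level (Suc i)) n"
    and mn: "m \<subseteq> n" "\<Delta> ` m \<subseteq> n"
  shows "\<exists>n'. max_inv_ideal s (level (Suc (Suc i))) n' \<and> n \<subseteq> n' \<and> \<Delta> ` n \<subseteq> n'"
proof -
  let ?C = "level (Suc (Suc i))"
  obtain I where I: "ideal_in ?C I" "n \<subseteq> I" "\<Delta> ` n \<subseteq> I" "1 \<notin> I"
    using proper_prolongation[OF assms] by blast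
  \<comment> \<open>The generated ideal is taken as an intersection to have leastness at hand;
    \<open>I\<close> shows that the family is nonempty.\<close>
  define J where "J = \<Inter>{I. ideal_in ?C I \<and> n \<subseteq> I \<and> \<Delta> ` n \<subseteq> I}"
  have J_least: "J \<subseteq> K" if "ideal_in ?C K" "n \<subseteq> K" "\<Delta> ` n \<subseteq> K" for K
    using that unfolding J_def by blast
  have J: "ideal_in ?C J" "n \<subseteq> J" "\<Delta> ` n \<subseteq> J"
  proof -
    show "ideal_in ?C J"
    proof (rule ideal_inI)
      show "J \<subseteq> ?C" using I J_least ideal_inD(1)[OF I(1)] by blast
      show "0 \<in> J" unfolding J_def using ideal_inD(2) by blast
      show "x + y \<in> J" if "x \<in> J" "y \<in> J" for x y
      proof -
        have "x + y \<in> K" if K: "ideal_in ?C K" "n \<subseteq> K" "\<Delta> ` n \<subseteq> K" for K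
          using J_least[OF K] \<open>x \<in> J\<close> \<open>y \<in> J\<close> by (intro ideal_inD(3)[OF K(1)]) auto
        then show ?thesis unfolding J_def by blast
      qed
      show "r * x \<in> J" if "r \<in> ?C" "x \<in> J" for r x
      proof -
        have "r * x \<in> K" if K: "ideal_in ?C K" "n \<subseteq> K" "\<Delta> ` n \<subseteq> K" for K
          using J_least[OF K] \<open>x \<in> J\<close> \<open>r \<in> ?C\<close> by (intro ideal_inD(4)[OF K(1)]) auto
        then show ?thesis unfolding J_def by blast
      qed
    qed
    show "n \<subseteq> J" "\<Delta> ` n \<subseteq> J" unfolding J_def by blast+
  qed
  \<comment> \<open>Stability follows from leastness: the preimage of \<open>J\<close> under
    \<open>s\<close> is an ideal containing \<open>n\<close> and \<open>\<Delta> n\<close>.\<close>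
  have "J \<subseteq> {x \<in> ?C. s x \<in> J}"
  proof (rule J_least)
    show "ideal_in ?C {x \<in> ?C. s x \<in> J}"
    proof (rule ideal_inI)
      fix r x assume "r \<in> ?C" "x \<in> {x \<in> ?C. s x \<in> J}"
      then show "r * x \<in> {x \<in> ?C. s x \<in> J}"
        using ideal_inD(4)[OF J(1) s_level] by (simp only: mem_Collect_eq s.hom_mult polys_in.mult)
    qed (use ideal_inD(2,3)[OF J(1)] in \<open>auto simp: s.hom_add polys_in_closed(2) polys_in.add\<close>)
    show "n \<subseteq> {x \<in> ?C. s x \<in> J}"
      using J(1,2) max_inv_idealD(2)[OF n] ideal_inD(1)[OF J(1)] by blast
    show "\<Delta> ` n \<subseteq> {x \<in> ?C. s x \<in> J}"
      using J(1,3) max_inv_idealD(2)[OF n] ideal_inD(1)[OF J(1)] s_\<Delta> by auto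
  qed
  then have "s ` J \<subseteq> J" by blast
  moreover have "1 \<notin> J" using J_least[OF I(1-3)] I(4) by blast
  ultimately obtain n' where "J \<subseteq> n'" "max_inv_ideal s ?C n'"
    using max_inv_ideal_exists[OF J(1)] by metis
  then show ?thesis using J by blast
qed

text \<open>\<open>M\<close> is the union of a tower \<open>m i\<close> obtained by dependent
  choice. A proper stable ideal above \<open>M\<close> meets each level exactly in
  \<open>m i\<close>, hence equals \<open>M\<close>, as every polynomial lies in some level.\<close>

theorem invariant_maximal_ideal_exists:
  assumes J: "ideal_in (level 1) J" "s ` J \<subseteq> J" "1 \<notin> J"
  obtains M where "J \<subseteq> M" "\<Delta> ` M \<subseteq> M" "max_inv_ideal s UNIV M"
proof -
  have level0: "\<exists>c. x = Const c" if "x \<in> level 0" for x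
    using that
  proof induction
    case (add p q)
    then show ?case by (metis Const.hom_add)
  next
    case (mult p q)
    then show ?case by (metis Const.hom_mult)
  qed auto
  \<comment> \<open>Base of the tower: \<open>level 0\<close> is a copy of the field, whose only
    proper ideal is zero.\<close>
  have zero: "max_inv_ideal s (level 0) {0}"
    unfolding max_inv_ideal_def
  proof (intro conjI allI impI)
    show "ideal_in (level 0) {0}" by (rule ideal_inI) (auto simp: polys_in_closed(2))
    fix I assume I: "ideal_in (level 0) I \<and> s ` I \<subseteq> I \<and> 1 \<notin> I \<and> {0} \<subseteq> I"
    then have I': "ideal_in (level 0) I" "1 \<notin> I" by simp_all
    have "x = 0" if "x \<in> I" for x
    proof (rule ccontr)
      assume "x \<noteq> 0"
      obtain c where c: "x = Const c" using level0[OF ideal_inD(1)[OF I'(1) \<open>x \<in> I\<close>]] by blast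
      with \<open>x \<noteq> 0\<close> have "c \<noteq> 0" by auto
      then have "Const (inverse c) * x = 1" by (simp add: c flip: Const.hom_mult)
      moreover have "Const (inverse c) * x \<in> I" by (rule ideal_inD(4)[OF I'(1) polys_in.Const \<open>x \<in> I\<close>])
      ultimately show False using I'(2) by simp
    qed
    then show "I = {0}" using ideal_inD(2)[OF I'(1)] by blast
  qed auto
  obtain m1 where m1: "J \<subseteq> m1" "max_inv_ideal s (level 1) m1"
    using max_inv_ideal_exists[OF J] by metis
  \<comment> \<open>The choice runs over pairs of consecutive ideals because the next step needs
    both. The clause for \<open>i = 0\<close> pins the second ideal to \<open>m1\<close>, which
    brings \<open>J\<close> into the tower.\<close>
  define good where "good i x \<longleftrightarrow> max_inv_ideal s (level i) (fst x) \<and>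
    max_inv_ideal s (level (Suc i)) (snd x) \<and> fst x \<subseteq> snd x \<and> \<Delta> ` fst x \<subseteq> snd x \<and> (i = 0 \<longrightarrow> snd x = m1)" for i x
  have "\<exists>f. \<forall>i. good i (f i) \<and> fst (f (Suc i)) = snd (f i)"
  proof (rule dependent_nat_choice)
    show "\<exists>x. good 0 x"
      using zero m1 ideal_inD(2)[OF max_inv_idealD(1)[OF m1(2)]]
      by (intro exI[of _ "({0}, m1)"]) (simp add: good_def \<Delta>.zero)
    fix x i assume "good i x"
    then obtain n' where "max_inv_ideal s (level (Suc (Suc i))) n'" "snd x \<subseteq> n'" "\<Delta> ` snd x \<subseteq> n'"
      using prolongation_step[of i "fst x" "snd x"] by (auto simp: good_def)
    with \<open>good i x\<close> show "\<exists>y. good (Suc i) y \<and> fst y = snd x"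
      by (intro exI[of _ "(snd x, n')"]) (simp add: good_def)
  qed
  then obtain f where f: "\<And>i. good i (f i)" "\<And>i. fst (f (Suc i)) = snd (f i)" by blast
  define m where "m i = fst (f i)" for i
  have m: "max_inv_ideal s (level i) (m i)" "m i \<subseteq> m (Suc i)" "\<Delta> ` m i \<subseteq> m (Suc i)" for i
    using f(1)[of i] f(2)[of i] by (auto simp: good_def m_def)
  have mJ: "J \<subseteq> m 1" using f(1)[of 0] f(2)[of 0] m1(1) by (simp add: good_def m_def)
  have m_mono: "m i \<subseteq> m j" if "i \<le> j" for i j
    using that m(2) by (rule lift_Suc_mono_le[rotated])
  note mI = ideal_inD[OF max_inv_idealD(1)[OF m(1)]]
  have level: "\<exists>i. p \<in> level i" for p
  proof -
    obtain k where "p \<in> polys_in {..<k}" using polys_in_upto by blast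
    moreover have "k \<le> N * k" using N by simp
    ultimately show ?thesis using polys_in_mono[of "{..<k}" "{..<N * k}"] by auto
  qed
  have common: "\<exists>k. p \<in> m k \<and> q \<in> m k" if "p \<in> m i" "q \<in> m j" for p q i j
    using that m_mono[of i "max i j"] m_mono[of j "max i j"] by auto
  define M where "M = (\<Union>i. m i)"
  have ideal: "ideal_in UNIV M"
  proof (rule ideal_inI)
    fix p q assume "p \<in> M" "q \<in> M"
    then obtain k where "p \<in> m k" "q \<in> m k" using common unfolding M_def by blast
    then have "p + q \<in> m k" by (rule mI(3))
    then show "p + q \<in> M" unfolding M_def by blast
  next
    fix r p assume "p \<in> M"
    then obtain i where i: "p \<in> m i" unfolding M_def by blast
    obtain j where "r \<in> level j" using level by blast
    then have "r \<in> level (max i j)" "p \<in> m (max i j)"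
      using level_mono[of j "max i j"] m_mono[of i "max i j"] i by auto
    then have "r * p \<in> m (max i j)" by (rule mI(4))
    then show "r * p \<in> M" unfolding M_def by blast
  next
    show "0 \<in> M" using mI(2) unfolding M_def by blast
  qed simp
  have "max_inv_ideal s UNIV M"
    unfolding max_inv_ideal_def
  proof (intro conjI allI impI)
    show "s ` M \<subseteq> M" using max_inv_idealD(2)[OF m(1)] unfolding M_def by blast
    show "1 \<notin> M" using max_inv_idealD(3)[OF m(1)] unfolding M_def by blast
    fix I assume I: "ideal_in UNIV I \<and> s ` I \<subseteq> I \<and> 1 \<notin> I \<and> M \<subseteq> I"
    then have I': "ideal_in UNIV I" "\<And>x. x \<in> I \<Longrightarrow> s x \<in> I" "1 \<notin> I" "M \<subseteq> I"
      by auto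
    have "I \<inter> level i = m i" for i
    proof (rule max_inv_idealD(4)[OF m(1)])
      show "ideal_in (level i) (I \<inter> level i)"
        by (rule ideal_in_restrict[OF I'(1) is_subring_polys_in]) simp
      show "s ` (I \<inter> level i) \<subseteq> I \<inter> level i"
        by (intro image_subsetI IntI) (simp_all add: I'(2) s_level)
      show "1 \<notin> I \<inter> level i" using I'(3) by simp
      show "m i \<subseteq> I \<inter> level i"
      proof (intro subsetI IntI)
        fix x assume "x \<in> m i"
        then show "x \<in> level i" by (rule mI(1))
        show "x \<in> I" using \<open>x \<in> m i\<close> by (intro subsetD[OF I'(4)]) (auto simp: M_def)
      qed
    qed
    note I_level = this
    have "I \<subseteq> M"
    proof
      fix x assume "x \<in> I"
      obtain i where "x \<in> level i" using level[of x] by blast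
      then have "x \<in> m i" using \<open>x \<in> I\<close> I_level[of i] by blast
      then show "x \<in> M" unfolding M_def by blast
    qed
    then show "I = M" using I'(4) by simp
  qed (rule ideal)
  moreover have "J \<subseteq> M" using mJ unfolding M_def by blast
  moreover have "\<Delta> ` M \<subseteq> M" using m(3) unfolding M_def by blast
  ultimately show ?thesis by (intro that[of M])
qed

end

section \<open>The extension as a quotient of a polynomial ring\<close>

locale poly_quotient =
  fixes M :: "'r::comm_ring_1 set"
  assumes M: "ideal_in UNIV M"
begin

abbreviation base :: "'r ring" where "base \<equiv> ring_of_type_algebra"

lemma ideal_M: "ideal M base"
proof -
  interpret base: cring base ..
  show ?thesis
  proof (rule idealI)
    show "ring base" by (rule base.ring_axioms)
    show "subgroup M (add_monoid base)"
    proof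
      show "M \<subseteq> carrier (add_monoid base)" by simp
      show "x \<otimes>\<^bsub>add_monoid base\<^esub> y \<in> M" if "x \<in> M" "y \<in> M" for x y
        using that ideal_inD(3)[OF M] by simp
      show "\<one>\<^bsub>add_monoid base\<^esub> \<in> M" using ideal_inD(2)[OF M] by simp
      show "inv\<^bsub>add_monoid base\<^esub> x \<in> M" if "x \<in> M" for x
      proof -
        have "inv\<^bsub>add_monoid base\<^esub> x = - x"
          using type_ring_uminus[of x] by (simp only: a_inv_def)
        then show ?thesis using ideal_inD(4)[OF M, of "-1" x] that by simp
      qed
    qed
  qed (use ideal_inD(4,5)[OF M] in \<open>simp_all\<close>)
qed

sublocale base: cring base ..
sublocale ideal M base by (rule ideal_M)

definition Q :: "'r set ring" where "Q = base Quot M"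
definition \<kappa> :: "'r \<Rightarrow> 'r set" where "\<kappa> p = M +>\<^bsub>base\<^esub> p"

lemma Q_cring: "cring Q"
  unfolding Q_def by (rule quotient_is_cring) (rule base.is_cring)

sublocale Q: cring Q by (rule Q_cring)

lemma \<kappa>_ring_hom: "\<kappa> \<in> Ring.ring_hom base Q"
  using rcos_ring_hom unfolding \<kappa>_def Q_def .

sublocale \<kappa>: ring_hom_cring base Q \<kappa>
  using \<kappa>_ring_hom by unfold_locales

lemma \<kappa>_eq_iff: "\<kappa> p = \<kappa> q \<longleftrightarrow> p - q \<in> M"
proof -
  have "p \<ominus>\<^bsub>base\<^esub> q = p - q" by (simp add: a_minus_def)
  then show ?thesis
    using base.quotient_eq_iff_same_a_r_cos[OF ideal_M, of p q] by (simp add: \<kappa>_def)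
qed

lemma carrier_Q: "carrier Q = range \<kappa>"
  by (auto simp: Q_def FactRing_def A_RCOSETS_def' \<kappa>_def)

lemma \<kappa>_simps:
  "\<kappa> (p + q) = \<kappa> p \<oplus>\<^bsub>Q\<^esub> \<kappa> q" "\<kappa> (p * q) = \<kappa> p \<otimes>\<^bsub>Q\<^esub> \<kappa> q" "\<kappa> 1 = \<one>\<^bsub>Q\<^esub>" "\<kappa> 0 = \<zero>\<^bsub>Q\<^esub>"
  "\<kappa> (- p) = \<ominus>\<^bsub>Q\<^esub> \<kappa> p" "\<kappa> p \<in> carrier Q"
  using \<kappa>.hom_add[of p q] \<kappa>.hom_mult[of p q] \<kappa>.hom_one \<kappa>.hom_zero \<kappa>.hom_a_inv[of p] \<kappa>.hom_closed[of p]
  by simp_all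

lemma Q_cases: assumes "x \<in> carrier Q" obtains p where "x = \<kappa> p"
  using assms by (auto simp: carrier_Q)

text \<open>The value goes through an arbitrary representative; \<open>descend_\<kappa>\<close>
  shows independence of it when \<open>f\<close> respects differences and preserves
  \<open>M\<close>.\<close>

definition descend :: "('r \<Rightarrow> 'r) \<Rightarrow> 'r set \<Rightarrow> 'r set" where
  "descend f x = \<kappa> (f (SOME p. \<kappa> p = x))"

lemma descend_\<kappa>:
  assumes "\<And>p q. f (p - q) = f p - f q" "f ` M \<subseteq> M"
  shows "descend f (\<kappa> p) = \<kappa> (f p)"
proof -
  have "\<kappa> (SOME q. \<kappa> q = \<kappa> p) = \<kappa> p" by (rule someI) simp
  then show ?thesis using assms by (auto simp: descend_def \<kappa>_eq_iff simp flip: assms(1))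
qed

section \<open>Matrices and determinants over the quotient\<close>

lemma mat_mult_\<kappa>:
  assumes "U \<in> carrier_mat n n" "V \<in> carrier_mat n n"
  shows "ring_mat_mult Q (map_mat \<kappa> U) (map_mat \<kappa> V) = map_mat \<kappa> (U * V)"
proof (intro eq_matI)
  fix i j assume "i < dim_row (map_mat \<kappa> (U * V))" "j < dim_col (map_mat \<kappa> (U * V))"
  then have ij: "i < n" "j < n" using assms by auto
  have "\<kappa> (\<Sum>k\<in>{0..<n}. U $$ (i, k) * V $$ (k, j)) =
      (\<Oplus>\<^bsub>Q\<^esub>k\<in>{0..<n}. \<kappa> (U $$ (i, k) * V $$ (k, j)))"
    using \<kappa>.hom_finsum[of "\<lambda>k. U $$ (i, k) * V $$ (k, j)" "{0..<n}"]
    by (simp add: type_ring_finsum comp_def)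
  also have "\<dots> = (\<Oplus>\<^bsub>Q\<^esub>k\<in>{0..<n}. map_mat \<kappa> U $$ (i, k) \<otimes>\<^bsub>Q\<^esub> map_mat \<kappa> V $$ (k, j))"
    using assms ij by (intro Q.finsum_cong) (auto simp: \<kappa>_simps simp_implies_def)
  finally show "ring_mat_mult Q (map_mat \<kappa> U) (map_mat \<kappa> V) $$ (i, j) = map_mat \<kappa> (U * V) $$ (i, j)"
    using assms ij by (simp add: ring_mat_mult_def scalar_prod_def)
qed (use assms in \<open>auto simp: ring_mat_mult_def\<close>)

lemma det_\<kappa>:
  assumes "U \<in> carrier_mat n n"
  shows "ring_det Q (map_mat \<kappa> U) = \<kappa> (det U)"
proof -
  have dim: "dim_row U = n" "dim_col U = n" using assms by auto
  let ?t = "\<lambda>p. (if evenperm p then 1 else - 1) * (\<Prod>i\<in>{0..<n}. U $$ (i, p i))"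
  have "\<kappa> (?t p) = (if evenperm p then \<one>\<^bsub>Q\<^esub> else \<ominus>\<^bsub>Q\<^esub> \<one>\<^bsub>Q\<^esub>) \<otimes>\<^bsub>Q\<^esub>
      (\<Otimes>\<^bsub>Q\<^esub>i\<in>{0..<n}. map_mat \<kappa> U $$ (i, p i))" if "p permutes {0..<n}" for p
  proof -
    have "\<kappa> (\<Prod>i\<in>{0..<n}. U $$ (i, p i)) = (\<Otimes>\<^bsub>Q\<^esub>i\<in>{0..<n}. \<kappa> (U $$ (i, p i)))"
      using \<kappa>.hom_finprod[of "\<lambda>i. U $$ (i, p i)" "{0..<n}"] by (simp add: type_ring_finprod comp_def)
    also have "\<dots> = (\<Otimes>\<^bsub>Q\<^esub>i\<in>{0..<n}. map_mat \<kappa> U $$ (i, p i))"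
      using dim permutes_in_image[OF that]
      by (intro Q.finprod_cong) (simp_all add: \<kappa>_simps(6) simp_implies_def)
    finally show ?thesis by (simp add: \<kappa>_simps(2,3,5))
  qed
  then have "(\<Oplus>\<^bsub>Q\<^esub>p\<in>{p. p permutes {0..<n}}. \<kappa> (?t p)) = ring_det Q (map_mat \<kappa> U)"
    unfolding ring_det_def index_map_mat(2) dim
    by (intro Q.finsum_cong) (simp_all only: simp_implies_def mem_Collect_eq Pi_def \<kappa>_simps(6) simp_thms)
  then have "ring_det Q (map_mat \<kappa> U) = (\<Oplus>\<^bsub>Q\<^esub>p\<in>{p. p permutes {0..<n}}. \<kappa> (?t p))"
    by (rule sym)
  also have "\<dots> = \<kappa> (\<Sum>p\<in>{p. p permutes {0..<n}}. ?t p)"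
    using \<kappa>.hom_finsum[of ?t "{p. p permutes {0..<n}}"]
    by (simp add: type_ring_finsum comp_def finite_permutations)
  also have "(\<Sum>p\<in>{p. p permutes {0..<n}}. ?t p) = det U"
    using dim by (simp add: det_def sign_def, intro sum.cong) auto
  finally show ?thesis .
qed

text \<open>The equivalence \<open>s p \<in> M \<longleftrightarrow> p \<in> M\<close> makes the
  induced map well defined in one direction and injective in the other; surjectivity is inherited
  from \<open>s\<close>.\<close>

lemma sd_ring_Q:
  assumes s: "comm_ring_hom s" "surj s" "\<And>p. s p \<in> M \<longleftrightarrow> p \<in> M"
    and D: "derivation D" "D ` M \<subseteq> M" and comm: "\<And>p. s (D p) = D (s p)"
  shows "sd_ring Q (descend s) (descend D)"
    and "\<And>p. descend s (\<kappa> p) = \<kappa> (s p)" and "\<And>p. descend D (\<kappa> p) = \<kappa> (D p)"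
proof -
  interpret s: comm_ring_hom s by fact
  interpret D: derivation D by fact
  have minus: "s (p - q) = s p - s q" for p q
    using s.hom_add[of "p - q" q] by simp
  show ds: "descend s (\<kappa> p) = \<kappa> (s p)" for p by (rule descend_\<kappa>) (use minus s(3) in auto)
  show dD: "descend D (\<kappa> p) = \<kappa> (D p)" for p by (rule descend_\<kappa>) (use D.diff D(2) in auto)
  have "descend s \<in> ring_iso Q Q"
  proof (rule ring_iso_memI)
    show "bij_betw (descend s) (carrier Q) (carrier Q)"
      unfolding bij_betw_def
    proof
      show "inj_on (descend s) (carrier Q)"
      proof (rule inj_onI)
        fix x y assume xy: "x \<in> carrier Q" "y \<in> carrier Q" "descend s x = descend s y"
        then obtain p q where pq: "x = \<kappa> p" "y = \<kappa> q" by (metis Q_cases)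
        with xy show "x = y" by (simp add: ds \<kappa>_eq_iff s(3) flip: minus)
      qed
      have "descend s ` range \<kappa> = \<kappa> ` range s" by (auto simp: ds image_image)
      then show "descend s ` carrier Q = carrier Q" using s(2) by (simp add: carrier_Q)
    qed
    fix x y assume "x \<in> carrier Q" "y \<in> carrier Q"
    then obtain p q where "x = \<kappa> p" "y = \<kappa> q" by (auto simp: carrier_Q)
    then show "descend s (x \<otimes>\<^bsub>Q\<^esub> y) = descend s x \<otimes>\<^bsub>Q\<^esub> descend s y"
      "descend s (x \<oplus>\<^bsub>Q\<^esub> y) = descend s x \<oplus>\<^bsub>Q\<^esub> descend s y"
      by (simp_all add: ds s.hom_add s.hom_mult flip: \<kappa>_simps(1,2))
  next
    fix x assume "x \<in> carrier Q"
    then show "descend s x \<in> carrier Q" by (auto simp: carrier_Q ds)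
  next
    show "descend s \<one>\<^bsub>Q\<^esub> = \<one>\<^bsub>Q\<^esub>" using ds[of 1] by (simp add: \<kappa>_simps(3))
  qed
  moreover have "ring_derivation Q (descend D)"
    by (auto simp: ring_derivation_def carrier_Q dD D.add D.mult simp flip: \<kappa>_simps(1,2))
  moreover have "\<forall>x\<in>carrier Q. descend s (descend D x) = descend D (descend s x)"
    by (auto simp: carrier_Q ds dD comm)
  ultimately show "sd_ring Q (descend s) (descend D)"
    using Q_cring by (simp add: sd_ring_def)
qed

text \<open>A stable ideal of the quotient pulls back along \<open>\<kappa>\<close> to a stable
  ideal containing \<open>M\<close>, which either is \<open>M\<close> or contains
  \<open>1\<close>.\<close>

lemma simple_Q:
  assumes max: "max_inv_ideal s UNIV M" and ds: "\<And>p. descend s (\<kappa> p) = \<kappa> (s p)"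
  shows "simple_s_ring Q (descend s)"
  unfolding simple_s_ring_def
proof (intro conjI allI impI)
  have "\<kappa> 1 \<noteq> \<kappa> 0" using max_inv_idealD(3)[OF max] by (simp add: \<kappa>_eq_iff)
  then show "\<one>\<^bsub>Q\<^esub> \<noteq> \<zero>\<^bsub>Q\<^esub>" by (simp add: \<kappa>_simps(3,4))
  fix I assume "ideal I Q \<and> descend s ` I \<subseteq> I"
  then have I: "ideal I Q" and sI: "descend s ` I \<subseteq> I" by simp_all
  interpret I: ideal I Q by (rule I)
  let ?K = "{p. \<kappa> p \<in> I}"
  have K: "ideal_in UNIV ?K"
    by (rule ideal_inI) (auto simp: \<kappa>_simps(1,2,4) intro: I.zero_closed I.a_closed I.I_l_closed \<kappa>_simps(6))
  have sK: "s ` ?K \<subseteq> ?K" using sI by (auto simp flip: ds)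
  have MK: "M \<subseteq> ?K"
  proof
    fix p assume "p \<in> M"
    then have "\<kappa> p = \<kappa> 0" by (simp add: \<kappa>_eq_iff)
    then show "p \<in> ?K" using I.zero_closed by (simp add: \<kappa>_simps(4))
  qed
  show "I = {\<zero>\<^bsub>Q\<^esub>} \<or> I = carrier Q"
  proof (cases "1 \<in> ?K")
    case True
    then show ?thesis using I.one_imp_carrier by (simp add: \<kappa>_simps(3))
  next
    case False
    then have KM: "?K = M" by (rule max_inv_idealD(4)[OF max K sK _ MK])
    have "x = \<zero>\<^bsub>Q\<^esub>" if x: "x \<in> I" for x
    proof -
      obtain p where p: "x = \<kappa> p" by (rule Q_cases[OF I.Icarr[OF x]])
      then have "p \<in> ?K" using x by simp
      then have "p \<in> M" unfolding KM .
      then have "\<kappa> p = \<kappa> 0" by (simp add: \<kappa>_eq_iff)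
      then show ?thesis by (simp add: p \<kappa>_simps(4))
    qed
    then have "I \<subseteq> {\<zero>\<^bsub>Q\<^esub>}" by blast
    then show ?thesis using I.zero_closed by (intro disjI1 equalityI) simp_all
  qed
qed

end

section \<open>Passage from ring records to types, and the prolonged automorphism\<close>

lemma derivation_of_ring_derivation:
  "ring_derivation (ring_of_type_algebra :: 'a::comm_ring_1 ring) d \<Longrightarrow> derivation d"
  by unfold_locales (simp_all add: ring_derivation_def)

lemma comm_ring_hom_of_ring_iso:
  assumes "s \<in> ring_iso (ring_of_type_algebra :: 'a::comm_ring_1 ring) ring_of_type_algebra"
  shows "comm_ring_hom s" "surj s"
proof -
  have s: "s (x + y) = s x + s y" "s (x * y) = s x * s y" "s 1 = 1" for x y
    using ring_iso_memE[OF assms] by simp_all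
  then show "comm_ring_hom s"
    using s(1)[of 0 0] by unfold_locales simp_all
  show "surj s" using ring_iso_memE(5)[OF assms] by (simp add: bij_betw_def)
qed

text \<open>The extension of \<open>\<sigma>\<close> to the polynomial ring is forced by its values \<open>im\<close> on the first \<open>N\<close>
  variables: the variable \<open>j + N * k\<close> is the \<open>k\<close>-th derivative of the variable \<open>j\<close>.\<close>
lemma prolongation_exists:
  fixes \<sigma> \<delta> :: "'a::field_char_0 \<Rightarrow> 'a" and im :: "nat \<Rightarrow> 'a poly_var"
  assumes \<delta>: "derivation \<delta>" and \<sigma>: "comm_ring_hom \<sigma>" "surj \<sigma>" and comm: "\<And>x. \<sigma> (\<delta> x) = \<delta> (\<sigma> x)"
    and N: "N > 0" and im: "\<And>j. j < N \<Longrightarrow> im j \<in> polys_in {..<N}"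
  obtains \<Delta> s where "prolongation \<delta> N \<Delta> s" "\<And>c. s (Const c) = Const (\<sigma> c)"
    "\<And>j. j < N \<Longrightarrow> s (Var j) = im j"
proof -
  interpret \<sigma>: comm_ring_hom \<sigma> by fact
  obtain \<Delta> where \<Delta>: "derivation \<Delta>" "\<And>c. \<Delta> (Const c) = Const (\<delta> c)" "\<And>v. \<Delta> (Var v) = Var (v + N)"
    by (rule derivation_exists[OF \<delta>, where a = "\<lambda>v. Var (v + N)"]) (rule that; assumption)
  interpret \<Delta>: derivation \<Delta> by fact
  have h: "comm_ring_hom (\<lambda>c. Const (\<sigma> c))"
    by unfold_locales (simp_all add: \<sigma>.hom_add \<sigma>.hom_mult Const.hom_add Const.hom_mult)
  define s where "s = eval_poly (\<lambda>c. Const (\<sigma> c)) (\<lambda>v. (\<Delta> ^^ (v div N)) (im (v mod N)))"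
  note s = eval_poly_hom[OF h, where a = "\<lambda>v. (\<Delta> ^^ (v div N)) (im (v mod N))", folded s_def]
  interpret s: comm_ring_hom s by (rule s(1))
  have s\<Delta>: "s (\<Delta> p) = \<Delta> (s p)" for p
    by (induction p rule: poly_var_induct)
      (use N in \<open>simp_all add: s(2,3) \<Delta>(2,3) comm s.hom_add s.hom_mult \<Delta>.add \<Delta>.mult\<close>)
  have \<Delta>_level: "\<Delta> p \<in> polys_in {..<N * Suc i}" if "p \<in> polys_in {..<N * i}" for p i
    by (rule polys_in_derivation_closed[OF \<Delta>(1) that])
      (simp_all add: \<Delta>(2,3) polys_in.Const polys_in.Var)
  \<comment> \<open>\<open>im j\<close> already involves the derivatives of order zero, hence
    \<open>Suc k\<close> instead of \<open>k\<close>.\<close>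
  have iterate: "(\<Delta> ^^ k) (im j) \<in> polys_in {..<N * Suc k}" if "j < N" for j k
  proof (induction k)
    case 0
    show ?case using im[OF that] by simp
  next
    case (Suc k)
    then have "\<Delta> ((\<Delta> ^^ k) (im j)) \<in> polys_in {..<N * Suc (Suc k)}" by (rule \<Delta>_level)
    then show ?case by simp
  qed
  have "s p \<in> polys_in {..<N * i}" if "p \<in> polys_in {..<N * i}" for p i
    using that
  proof induction
    case (Var v)
    then have "v div N < i" using N by (simp add: less_mult_imp_div_less mult.commute)
    then have "N * Suc (v div N) \<le> N * i" by (intro mult_le_mono2) simp
    then have "polys_in {..<N * Suc (v div N)} \<subseteq> (polys_in {..<N * i} :: 'a poly_var set)"
      by (intro polys_in_mono) auto
    then show ?case using iterate[of "v mod N" "v div N"] N by (auto simp: s(3))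
  qed (simp_all add: s(2) s.hom_add s.hom_mult polys_in.Const polys_in.add polys_in.mult)
  then have "prolongation \<delta> N \<Delta> s"
    using N \<delta> \<Delta> s(1) s\<Delta> by (simp add: prolongation_def)
  then show ?thesis by (rule that) (simp_all add: s(2,3))
qed

lemma (in prolongation) iterate_Var: "(\<Delta> ^^ k) (Var v) = Var (v + N * k)"
  by (induction k) (simp_all add: \<Delta>_Var algebra_simps)

text \<open>The range of \<open>s\<close> is closed under \<open>\<Delta>\<close> because the two
  commute, so the first \<open>N\<close> variables bring all their derivatives along.\<close>

lemma (in prolongation) surj_s:
  assumes "range Const \<subseteq> range s" "\<And>j. j < N \<Longrightarrow> Var j \<in> range s"
  shows "surj s"
proof -
  have \<Delta>_range: "\<Delta> p \<in> range s" if "p \<in> range s" for p using that by (auto simp flip: s_\<Delta>)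
  have "p \<in> range s" for p
  proof (induction p rule: poly_var_induct)
    case (Var v)
    have "(\<Delta> ^^ k) (Var (v mod N)) \<in> range s" for k
      by (induction k) (use assms(2)[of "v mod N"] N \<Delta>_range in auto)
    from this[of "v div N"] show ?case by (simp add: iterate_Var)
  next
    case (add p q)
    then obtain p' q' where "p = s p'" "q = s q'" by blast
    then show ?case by (simp flip: s.hom_add)
  next
    case (mult p q)
    then obtain p' q' where "p = s p'" "q = s q'" by blast
    then show ?case by (simp flip: s.hom_mult)
  qed (use assms(1) in blast)
  then show ?thesis by blast
qed

section \<open>Determinants and inverses of matrices\<close>

lemma det_in_subring:
  assumes B: "is_subring B" and U: "U \<in> carrier_mat n n" "\<And>i j. i < n \<Longrightarrow> j < n \<Longrightarrow> U $$ (i, j) \<in> B"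
  shows "det U \<in> B"
proof -
  note BD = is_subringD[OF B]
  have sum: "sum f S \<in> B" if "\<And>k. k \<in> S \<Longrightarrow> f k \<in> B" for f and S :: "(nat \<Rightarrow> nat) set"
    using that by (induction S rule: infinite_finite_induct) (simp_all add: BD(2,5))
  have prod: "prod f S \<in> B" if "\<And>k. k \<in> S \<Longrightarrow> f k \<in> B" for f and S :: "nat set"
    using that by (induction S rule: infinite_finite_induct) (simp_all add: BD(1,6))
  have "signof p * (\<Prod>i\<in>{0..<n}. U $$ (i, p i)) \<in> B" if "p permutes {0..<n}" for p
    using U(2) permutes_in_image[OF that] by (intro BD(6) prod) (auto simp: sign_def BD(1,4))
  then show ?thesis using U(1) by (auto simp: det_def intro!: sum)
qed

lemma map_mat_mult:
  assumes "comm_ring_hom h" "U \<in> carrier_mat n n" "V \<in> carrier_mat n n"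
  shows "map_mat h (U * V) = map_mat h U * map_mat h V"
proof -
  interpret comm_ring_hom h by fact
  show ?thesis using mat_hom_mult[OF assms(2,3)] .
qed

lemma invertible_mat_left_inverse:
  fixes A :: "'a::field mat"
  assumes "A \<in> carrier_mat n n" "invertible_mat A"
  obtains B where "B \<in> carrier_mat n n" "B * A = 1\<^sub>m n" "det A \<noteq> 0"
proof -
  obtain B where AB: "A * B = 1\<^sub>m n" and BA: "B * A = 1\<^sub>m (dim_row B)"
    using assms unfolding invertible_mat_def inverts_mat_def by auto
  have "dim_col B = n" using arg_cong[OF AB, of dim_col] by simp
  moreover have "dim_row B = n" using arg_cong[OF BA, of dim_col] assms by auto
  ultimately have B: "B \<in> carrier_mat n n" by auto
  then have "det A * det B = 1" using det_mult[OF assms(1) B] AB by simp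
  then have "det A \<noteq> 0" by auto
  with B BA show ?thesis by (intro that) auto
qed

theorem proposition1p16:
  fixes \<sigma> \<delta> :: "'a::field_char_0 \<Rightarrow> 'a"
    and \<nu> :: nat
    and A :: "'a mat"
  assumes "sd_ring ring_of_type_algebra \<sigma> \<delta>"
    and "\<nu> \<ge> 1"
    and "A \<in> carrier_mat \<nu> \<nu>" and "invertible_mat A"
  shows "\<exists>(R :: 'a poly_coset ring) \<sigma>' \<delta>' \<iota>.
           sd_extension ring_of_type_algebra \<sigma> \<delta> R \<sigma>' \<delta>' \<iota> \<and>
           (\<exists>Z \<in> ring_GL R \<nu>.
              map_mat \<sigma>' Z = ring_mat_mult R (map_mat \<iota> A) Z \<and>
              d_generated_by (ring_of_type_algebra :: 'a ring) R \<delta>' \<iota>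
                (elements_mat Z \<union> {inv\<^bsub>R\<^esub> (ring_det R Z)})) \<and>
           simple_s_ring R \<sigma>'"
proof -
  note A = assms(3)
  have \<delta>: "derivation \<delta>" and \<sigma>: "comm_ring_hom \<sigma>" "surj \<sigma>" and comm: "\<And>x. \<sigma> (\<delta> x) = \<delta> (\<sigma> x)"
    using assms(1) by (simp_all add: sd_ring_def derivation_of_ring_derivation comm_ring_hom_of_ring_iso)
  interpret \<sigma>: comm_ring_hom \<sigma> by fact
  obtain B where B: "B \<in> carrier_mat \<nu> \<nu>" "B * A = 1\<^sub>m \<nu>" and detA: "det A \<noteq> 0"
    using invertible_mat_left_inverse[OF A assms(4)] by metis
  \<comment> \<open>One indeterminate for each entry of \<open>Z\<close>, numbered row by row, and a
    last one, \<open>w\<close>, for the inverse determinant.\<close>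
  define N where "N = Suc (\<nu> * \<nu>)"
  have "N > 0" by (simp add: N_def)
  define Z :: "'a poly_var mat" where "Z = mat \<nu> \<nu> (\<lambda>(i, j). Var (i * \<nu> + j))"
  define w :: "'a poly_var" where "w = Var (\<nu> * \<nu>)"
  have Z: "Z \<in> carrier_mat \<nu> \<nu>" by (simp add: Z_def)
  have CA: "map_mat Const A \<in> carrier_mat \<nu> \<nu>" using A by simp
  have index: "i * \<nu> + j < \<nu> * \<nu>" if "i < \<nu>" "j < \<nu>" for i j
  proof -
    have "i * \<nu> + j < Suc i * \<nu>" using that(2) by simp
    also have "\<dots> \<le> \<nu> * \<nu>" using that(1) by (intro mult_le_mono1) simp
    finally show ?thesis .
  qed
  have index_split: "k div \<nu> < \<nu>" "k mod \<nu> < \<nu>" "(k div \<nu>) * \<nu> + k mod \<nu> = k" if "k < \<nu> * \<nu>" for k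
    using that assms(2) by (simp_all add: less_mult_imp_div_less)
  \<comment> \<open>The values encode \<open>\<sigma>(Z) = A Z\<close>; as \<open>w\<close> is to
    invert \<open>det Z\<close>, its image must be \<open>w\<close> divided by
    \<open>det A\<close>.\<close>
  define im :: "nat \<Rightarrow> 'a poly_var" where
    "im k = (if k < \<nu> * \<nu> then (map_mat Const A * Z) $$ (k div \<nu>, k mod \<nu>) else Const (inverse (det A)) * w)" for k
  have Z_level: "Z $$ (i, j) \<in> polys_in {..<N}" if "i < \<nu>" "j < \<nu>" for i j
    using that index[OF that] by (simp add: Z_def N_def polys_in.Var)
  have w_level: "w \<in> polys_in {..<N}" by (simp add: w_def N_def polys_in.Var)
  have sum_level: "sum f S \<in> polys_in {..<N}" if "\<And>k. k \<in> S \<Longrightarrow> f k \<in> polys_in {..<N}" for f :: "nat \<Rightarrow> 'a poly_var" and S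
    using that by (induction S rule: infinite_finite_induct) (simp_all add: polys_in_closed(2) polys_in.add)
  have im_level: "im k \<in> polys_in {..<N}" if "k < N" for k
  proof (cases "k < \<nu> * \<nu>")
    case True
    then show ?thesis
      using Z CA A index_split[OF True]
      by (auto simp: im_def scalar_prod_def intro!: sum_level polys_in.mult polys_in.Const Z_level)
  next
    case False
    then show ?thesis by (simp add: im_def polys_in.mult polys_in.Const w_level)
  qed
  obtain \<Delta> s where pr: "prolongation \<delta> N \<Delta> s" and s_Const: "\<And>c. s (Const c) = Const (\<sigma> c)"
    and s_im: "\<And>j. j < N \<Longrightarrow> s (Var j) = im j"
    by (rule prolongation_exists[of \<delta> \<sigma> N im])
      (use \<delta> \<sigma> \<open>N > 0\<close> in \<open>simp_all add: comm im_level\<close>)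
  interpret prolongation \<delta> N \<Delta> s by fact
  have sZ: "map_mat s Z = map_mat Const A * Z"
  proof (rule eq_matI)
    fix i j assume "i < dim_row (map_mat Const A * Z)" "j < dim_col (map_mat Const A * Z)"
    then have ij: "i < \<nu>" "j < \<nu>" using A Z by auto
    then show "map_mat s Z $$ (i, j) = (map_mat Const A * Z) $$ (i, j)"
      using index[OF ij] by (simp add: Z_def s_im N_def im_def)
  qed (use A Z in auto)
  have sw: "s w = Const (inverse (det A)) * w"
    by (simp add: w_def s_im N_def im_def)
  have "surj s"
  proof (rule surj_s)
    show Const_range: "range Const \<subseteq> range s"
    proof
      fix x :: "'a poly_var" assume "x \<in> range Const"
      then obtain c where "x = Const c" by blast
      moreover obtain c' where "c = \<sigma> c'" using \<sigma>(2) by (metis surjD)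
      ultimately show "x \<in> range s" using s_Const[of c'] by (metis rangeI)
    qed
    have mult_range: "x * y \<in> range s" if xy: "x \<in> range s" "y \<in> range s" for x y
    proof -
      obtain x' y' where "x = s x'" "y = s y'" using xy by blast
      then show ?thesis by (simp flip: s.hom_mult)
    qed
    have sum_range: "sum f S \<in> range s" if "\<And>k. k \<in> S \<Longrightarrow> f k \<in> range s" for f :: "nat \<Rightarrow> 'a poly_var" and S
    proof -
      have "\<forall>k. \<exists>g. k \<in> S \<longrightarrow> f k = s g" using that by blast
      then obtain g where "\<And>k. k \<in> S \<Longrightarrow> f k = s (g k)" by metis
      then have "sum f S = s (sum g S)" by (simp add: s.hom_sum)
      then show ?thesis by blast
    qed
    fix k assume "k < N"
    show "Var k \<in> range s"
    proof (cases "k < \<nu> * \<nu>")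
      case True
      let ?i = "k div \<nu>" and ?j = "k mod \<nu>"
      note ij = index_split[OF True]
      \<comment> \<open>Solving for \<open>Z\<close> with the inverse \<open>B\<close> of
        \<open>A\<close> writes each entry through elements of the range of \<open>s\<close>; the
        constants belong to it because \<open>\<sigma>\<close> is onto.\<close>
      have "map_mat Const B * map_mat s Z = Z"
      proof -
        have "map_mat Const B * (map_mat Const A * Z) = map_mat Const (B * A) * Z"
          using B(1) A Z by (simp add: map_mat_mult[OF Const_hom] assoc_mult_mat[of _ \<nu> \<nu> _ \<nu>])
        also have "\<dots> = Z" using Z by (simp add: B(2) Const.mat_hom_one)
        finally show ?thesis by (simp only: sZ)
      qed
      then have "Var k = (map_mat Const B * map_mat s Z) $$ (?i, ?j)"
        using ij by (simp add: Z_def)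
      also have "\<dots> = (\<Sum>l\<in>{0..<\<nu>}. Const (B $$ (?i, l)) * s (Z $$ (l, ?j)))"
        using ij B(1) Z by (simp add: scalar_prod_def)
      also have "\<dots> \<in> range s" by (intro sum_range mult_range) (use Const_range in auto)
      finally show ?thesis .
    next
      case False
      then have k: "k = \<nu> * \<nu>" using \<open>k < N\<close> by (simp add: N_def)
      have "Const (det A) * s w = Const (det A * inverse (det A)) * w"
        by (simp add: sw Const.hom_mult mult.assoc)
      then have "Var k = Const (det A) * s w" using detA by (simp add: k w_def)
      also have "\<dots> \<in> range s" by (intro mult_range) (use Const_range in auto)
      finally show ?thesis .
    qed
  qed
  \<comment> \<open>\<open>u\<close> expresses that \<open>w\<close> inverts \<open>det Z\<close>.
    The factors \<open>det A\<close> and its inverse cancel under \<open>s\<close>, so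
    \<open>u\<close> is fixed and generates a stable ideal.\<close>
  define u where "u = w * det Z - 1"
  have su: "s u = u"
  proof -
    have "s (det Z) = det (map_mat Const A * Z)" by (simp add: s.hom_det sZ flip: sZ)
    also have "\<dots> = Const (det A) * det Z" using det_mult[OF CA Z] by (simp add: Const.hom_det)
    finally have "s (w * det Z) = Const (inverse (det A)) * Const (det A) * (w * det Z)"
      by (simp add: s.hom_mult sw mult_ac)
    also have "\<dots> = w * det Z" using detA by (simp flip: Const.hom_mult)
    finally show ?thesis using s.hom_minus[of "w * det Z" 1] by (simp add: u_def)
  qed
  have level1: "level 1 = polys_in {..<N}" by simp
  define J where "J = (\<lambda>r. r * u) ` level 1"
  have detZ_level: "det Z \<in> polys_in {..<N}"
    using is_subring_polys_in Z Z_level by (rule det_in_subring)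
  have u_level: "u \<in> polys_in {..<N}"
    unfolding u_def by (intro polys_in_closed(3) polys_in.mult w_level detZ_level polys_in_closed(1))
  have J: "ideal_in (level 1) J"
  proof (rule ideal_inI)
    show "J \<subseteq> level 1" using u_level by (auto simp: J_def intro: polys_in.mult)
    show "0 \<in> J" unfolding J_def by (rule image_eqI[of _ _ 0]) (simp_all add: polys_in_closed(2))
    fix x y assume "x \<in> J" "y \<in> J"
    then obtain p q where "x = p * u" "y = q * u" "p \<in> level 1" "q \<in> level 1" by (auto simp: J_def)
    then show "x + y \<in> J" unfolding J_def by (intro image_eqI[of _ _ "p + q"] polys_in.add) (simp_all add: distrib_right)
  next
    fix r x assume "r \<in> level 1" "x \<in> J"
    then obtain p where "x = p * u" "p \<in> level 1" by (auto simp: J_def)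
    with \<open>r \<in> level 1\<close> show "r * x \<in> J" unfolding J_def by (intro image_eqI[of _ _ "r * p"] polys_in.mult) (simp_all add: mult.assoc)
  qed
  have sJ: "s ` J \<subseteq> J"
  proof
    fix x assume "x \<in> s ` J"
    then obtain p where p: "x = s (p * u)" "p \<in> level 1" unfolding J_def by blast
    then have "x = s p * u" by (simp add: s.hom_mult su)
    then show "x \<in> J" using s_level[OF p(2)] unfolding J_def by blast
  qed
  have J1: "1 \<notin> J"
  proof
    \<comment> \<open>\<open>u\<close> vanishes at the point where \<open>Z\<close> is the identity
      and \<open>w = 1\<close>, so it generates a proper ideal. The condition
      \<open>v div \<nu> = v mod \<nu>\<close> picks out the diagonal entries.\<close>
    define e where "e = eval_poly (\<lambda>c::'a. c) (\<lambda>v. if v = \<nu> * \<nu> \<or> v div \<nu> = v mod \<nu> then 1 else 0)"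
    have id: "comm_ring_hom (\<lambda>c::'a. c)" by unfold_locales simp_all
    note e = eval_poly_hom[OF id, where a = "\<lambda>v. if v = \<nu> * \<nu> \<or> v div \<nu> = v mod \<nu> then 1 else 0", folded e_def]
    interpret e: comm_ring_hom e by (rule e(1))
    have "map_mat e Z = 1\<^sub>m \<nu>"
    proof (rule eq_matI)
      fix i j assume "i < dim_row (1\<^sub>m \<nu> :: 'a mat)" "j < dim_col (1\<^sub>m \<nu> :: 'a mat)"
      then have ij: "i < \<nu>" "j < \<nu>" by simp_all
      then show "map_mat e Z $$ (i, j) = 1\<^sub>m \<nu> $$ (i, j)"
        using index[OF ij] by (simp add: Z_def e(3))
    qed (use Z in auto)
    then have "e (det Z) = 1" by (simp flip: e.hom_det)
    then have "e u = 0" using e.hom_minus[of "w * det Z" 1] by (simp add: u_def e.hom_mult w_def e(3))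
    assume "1 \<in> J"
    then obtain r where "1 = r * u" unfolding J_def by blast
    then have "e 1 = e (r * u)" by (rule arg_cong)
    with \<open>e u = 0\<close> show False by (simp add: e.hom_mult)
  qed
  obtain M where MJ: "J \<subseteq> M" "\<Delta> ` M \<subseteq> M" "max_inv_ideal s UNIV M"
    using invariant_maximal_ideal_exists[OF J sJ J1] by metis
  have "u \<in> M" using MJ(1) by (auto simp: J_def intro!: subsetD[OF MJ(1)] image_eqI[of _ _ 1] polys_in_closed(1))
  interpret poly_quotient M by unfold_locales (rule max_inv_idealD(1)[OF MJ(3)])
  have sM: "s p \<in> M \<longleftrightarrow> p \<in> M" for p
    using max_inv_idealD(2)[OF MJ(3)] max_inv_ideal_vimage[OF s MJ(3), of p] by (auto simp: is_subring_def)
  note Q = sd_ring_Q[OF s \<open>surj s\<close> sM derivation MJ(2) s_\<Delta>]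
  let ?s = "descend s" and ?d = "descend \<Delta>" and ?\<iota> = "\<lambda>c. \<kappa> (Const c)" and ?Z = "map_mat \<kappa> Z"
  let ?S = "elements_mat ?Z \<union> {inv\<^bsub>Q\<^esub> (ring_det Q ?Z)}"
  have wdet: "\<kappa> (w * det Z) = \<kappa> 1" using \<open>u \<in> M\<close> by (simp add: \<kappa>_eq_iff u_def)
  have inv_det: "inv\<^bsub>Q\<^esub> (ring_det Q ?Z) = \<kappa> w"
  proof (rule Q.comm_inv_char)
    show "ring_det Q ?Z \<otimes>\<^bsub>Q\<^esub> \<kappa> w = \<one>\<^bsub>Q\<^esub>"
      using wdet by (simp add: det_\<kappa>[OF Z] mult.commute flip: \<kappa>_simps(2,3))
  qed (simp_all add: det_\<kappa>[OF Z] \<kappa>_simps(6))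
  have "?\<iota> \<in> Ring.ring_hom ring_of_type_algebra Q"
    by (rule ring_hom_memI) (simp_all add: \<kappa>_simps(6) Const.hom_add Const.hom_mult \<kappa>_simps(1,2,3))
  moreover have "inj ?\<iota>"
  proof (rule injI, rule ccontr)
    fix x y :: 'a assume "?\<iota> x = ?\<iota> y" "x \<noteq> y"
    \<comment> \<open>A nonzero constant is a unit and cannot lie in the proper ideal
      \<open>M\<close>.\<close>
    then have "Const (x - y) \<in> M" by (simp add: \<kappa>_eq_iff Const.hom_minus)
    then have *: "Const (inverse (x - y)) * Const (x - y) \<in> M" by (intro ideal_inD(4)[OF max_inv_idealD(1)[OF MJ(3)]]) simp
    have "inverse (x - y) * (x - y) = 1" using \<open>x \<noteq> y\<close> by simp
    then have "Const (inverse (x - y)) * Const (x - y) = 1" by (simp only: Const.hom_one flip: Const.hom_mult)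
    with * show False using max_inv_idealD(3)[OF MJ(3)] by simp
  qed
  ultimately have ext: "sd_extension ring_of_type_algebra \<sigma> \<delta> Q ?s ?d ?\<iota>"
    using assms(1) Q by (simp add: sd_extension_def s_Const \<Delta>_Const)
  have entries: "elements_mat (map_mat \<kappa> U) \<subseteq> carrier Q" for U
    by (auto simp: elements_mat_def \<kappa>_simps(6))
  have GL: "?Z \<in> ring_GL Q \<nu>"
  proof -
    \<comment> \<open>Cramer's rule: \<open>w\<close> times the adjugate inverts \<open>Z\<close>
      modulo \<open>M\<close>, where \<open>w * det Z\<close> becomes \<open>1\<close>.\<close>
    define Y' where "Y' = w \<cdot>\<^sub>m adj_mat Z"
    have Y': "Y' \<in> carrier_mat \<nu> \<nu>" using adj_mat(1)[OF Z] by (simp add: Y'_def)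
    have "Z * Y' = (w * det Z) \<cdot>\<^sub>m 1\<^sub>m \<nu>" "Y' * Z = (w * det Z) \<cdot>\<^sub>m 1\<^sub>m \<nu>"
      unfolding Y'_def using adj_mat[OF Z] Z
      by (auto simp: mult_smult_distrib[OF Z] smult_smult_assoc mult_smult_assoc_mat[of _ \<nu> \<nu>])
    moreover have "map_mat \<kappa> ((w * det Z) \<cdot>\<^sub>m 1\<^sub>m \<nu>) = ring_mat_one Q \<nu>"
      using wdet by (intro eq_matI) (auto simp: ring_mat_one_def \<kappa>_simps(3,4))
    ultimately have "ring_mat_mult Q ?Z (map_mat \<kappa> Y') = ring_mat_one Q \<nu>"
      "ring_mat_mult Q (map_mat \<kappa> Y') ?Z = ring_mat_one Q \<nu>"
      by (simp_all add: mat_mult_\<kappa>[OF Z Y'] mat_mult_\<kappa>[OF Y' Z])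
    moreover have "?Z \<in> ring_mats Q \<nu>" "map_mat \<kappa> Y' \<in> ring_mats Q \<nu>"
      using Z Y' entries by (simp_all add: ring_mats_def)
    ultimately show ?thesis unfolding ring_GL_def by blast
  qed
  have eq: "map_mat ?s ?Z = ring_mat_mult Q (map_mat ?\<iota> A) ?Z"
  proof -
    have "map_mat ?s ?Z = map_mat \<kappa> (map_mat s Z)" by (intro eq_matI) (simp_all add: Q(2))
    also have "\<dots> = ring_mat_mult Q (map_mat \<kappa> (map_mat Const A)) ?Z"
      by (simp add: sZ mat_mult_\<kappa>[OF CA Z])
    also have "map_mat \<kappa> (map_mat Const A) = map_mat ?\<iota> A" by (intro eq_matI) simp_all
    finally show ?thesis .
  qed
  have gen: "d_generated_by (ring_of_type_algebra :: 'a ring) Q ?d ?\<iota> ?S"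
    unfolding d_generated_by_def
  proof
    show S: "?S \<subseteq> carrier Q" using entries[of Z] by (simp add: inv_det \<kappa>_simps(6))
    let ?G = "?\<iota> ` carrier (ring_of_type_algebra :: 'a ring) \<union> {(?d ^^ i) x |i x. x \<in> ?S}"
    have iter: "(?d ^^ k) (\<kappa> p) = \<kappa> ((\<Delta> ^^ k) p)" for k p by (induction k) (simp_all add: Q(3))
    have "(?d ^^ k) x \<in> carrier Q" if x: "x \<in> ?S" for k x
    proof -
      obtain p where "x = \<kappa> p" using subsetD[OF S x] by (rule Q_cases)
      then show ?thesis by (simp add: iter \<kappa>_simps(6))
    qed
    then have G: "?G \<subseteq> carrier Q" by (auto simp: \<kappa>_simps(6))
    have "\<kappa> p \<in> generate_ring Q ?G" for p
    proof (induction p rule: poly_var_induct)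
      \<comment> \<open>\<open>Var v\<close> is the derivative of order \<open>v div N\<close> of
        the generator with index \<open>v mod N\<close>.\<close>
      case (Var v)
      have "\<kappa> (Var k) \<in> ?S" if "k < N" for k
      proof (cases "k < \<nu> * \<nu>")
        case True
        have "?Z $$ (k div \<nu>, k mod \<nu>) \<in> elements_mat ?Z"
          using index_split(1,2)[OF True] Z by (intro elements_matI[of _ \<nu> \<nu> "k div \<nu>" "k mod \<nu>"]) simp_all
        then show ?thesis using index_split[OF True] by (simp add: Z_def)
      next
        case False
        then have "k = \<nu> * \<nu>" using that by (simp add: N_def)
        then show ?thesis by (simp add: inv_det w_def)
      qed
      then have "\<kappa> (Var (v mod N)) \<in> ?S" using N by simp
      then have "(?d ^^ (v div N)) (\<kappa> (Var (v mod N))) \<in> ?G"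
        by - (rule UnI2, intro CollectI exI[of _ "v div N"] exI[of _ "\<kappa> (Var (v mod N))"] conjI[OF refl])
      then have "\<kappa> (Var v) \<in> ?G" by (simp add: iter iterate_Var)
      then show ?case by (rule generate_ring.incl)
    qed (auto simp: \<kappa>_simps(1,2) intro: generate_ring.intros)
    then show "generate_ring Q ?G = carrier Q"
      using Q.generate_ring_incl[OF G] by (auto simp: carrier_Q)
  qed
  show ?thesis
    using ext GL eq gen simple_Q[OF MJ(3) Q(2)] by blast
qed

end
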